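(* Let $\mu\in\mathbb{R}$, $\tau>0$, $\sigma>0$, and let $V\sim\mathcal N(\mu,\tau^2)$ and $U\sim\mathcal N(0,\sigma^2)$ be independent random variables. Let $\phi\colon\mathbb{R}\to\mathbb{R}$ and $P\colon\mathbb{R}\to\mathbb{R}$ be Borel-measurable functions, and set $Y_\phi=\phi(V)+U$. Then the pair $(\phi,P)$ is an equilibrium if and only if both of the following hold: $$\phi(v)=\frac{\sigma}{\tau}(v-\mu)\qquad\text{for every }v\in\mathbb{R},$$ $$P(Y_\phi)=\mu+\frac{\tau}{2\sigma}Y_\phi\qquad\text{almost surely}.$$
   Context: A pair $(\phi,P)$ of Borel-measurable functions $\mathbb{R}\to\mathbb{R}$ is called an equilibrium if the following two conditions hold. (1) Profit maximisation: for every $v\in\mathbb{R}$, $$\phi(v)\in\operatorname*{arg\,max}_{x\in\mathbb{R}}\ \mathbb{E}\big[(v-P(x+U))\,x\big].$$ (2) Market efficiency: $P(Y_\phi)=\mathbb{E}[V\mid Y_\phi]$ almost surely, where $Y_\phi=\phi(V)+U$. No integrability or regularity of $\phi$ beyond Borel measurability is assumed. Whenever (2) holds, $P(x+U)$ is integrable for every $x\in\mathbb{R}$, so the expectations in (1) are well defined and finite. *)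

theory Defs
  imports "HOL-Probability.Probability"
begin

definition order_flow :: "('a \<Rightarrow> real) \<Rightarrow> ('a \<Rightarrow> real) \<Rightarrow> (real \<Rightarrow> real) \<Rightarrow> 'a \<Rightarrow> real" where
  "order_flow V U \<phi> = (\<lambda>\<omega>. \<phi> (V \<omega>) + U \<omega>)"

(* The Bochner integral is 0 for a non-integrable integrand.  No integrability clause is needed here:
   market efficiency, the other half of the equilibrium, makes P (x + U) integrable for every x. *)
definition profit_maximising ::
    "'a measure \<Rightarrow> ('a \<Rightarrow> real) \<Rightarrow> (real \<Rightarrow> real) \<Rightarrow> (real \<Rightarrow> real) \<Rightarrow> bool" where
  "profit_maximising M U \<phi> P \<longleftrightarrow>
     (\<forall>v. is_arg_max (\<lambda>x. \<integral>\<omega>. (v - P (x + U \<omega>)) * x \<partial>M) (\<lambda>x. x \<in> UNIV) (\<phi> v))"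

(* The sigma-algebra generated by Y is the pullback of the Borel sigma-algebra along Y. *)
definition market_efficient ::
    "'a measure \<Rightarrow> ('a \<Rightarrow> real) \<Rightarrow> ('a \<Rightarrow> real) \<Rightarrow> (real \<Rightarrow> real) \<Rightarrow> (real \<Rightarrow> real) \<Rightarrow> bool" where
  "market_efficient M V U \<phi> P \<longleftrightarrow>
     (let Y = order_flow V U \<phi> in
        AE \<omega> in M. P (Y \<omega>) = real_cond_exp M (vimage_algebra (space M) Y borel) V \<omega>)"

definition equilibrium ::
    "'a measure \<Rightarrow> ('a \<Rightarrow> real) \<Rightarrow> ('a \<Rightarrow> real) \<Rightarrow> (real \<Rightarrow> real) \<Rightarrow> (real \<Rightarrow> real) \<Rightarrow> bool" where
  "equilibrium M V U \<phi> P \<longleftrightarrow>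
     \<phi> \<in> borel_measurable borel \<and> P \<in> borel_measurable borel \<and>
     profit_maximising M U \<phi> P \<and> market_efficient M V U \<phi> P"

end

theory Submission
  imports Defs
begin

text \<open>
  Write \<open>h x\<close> for the mean price \<open>E P(x + U)\<close> of an order \<open>x\<close>, \<open>X = \<phi> V\<close> for the order of the
  insider, and \<open>w v = (v - h (\<phi> v)) * \<phi> v\<close> for the profit of the insider who has seen \<open>v\<close>.  The
  quantity that decides everything is \<open>A = E (P(Y) U)\<close>, the expected loss of the noise traders.
  Efficiency of the price gives \<open>A \<le> \<sigma> * \<tau> / 2\<close>, optimality of the insider gives the reverse
  inequality, and the two equality cases are the two claims.

  Upper bound.  Since \<open>P(Y)\<close> is an orthogonal projection of \<open>V\<close>, the reflection \<open>2 P(Y) - V - \<mu>\<close>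
  has the same norm \<open>\<tau>\<close> as \<open>V - \<mu>\<close>.  As \<open>U\<close> is orthogonal to \<open>V\<close> and to constants,
  \<open>2 A = E ((2 P(Y) - V - \<mu>) U)\<close>, and Cauchy-Schwarz gives \<open>2 A \<le> \<tau> * \<sigma>\<close>.  Equality forces
  \<open>\<sigma> (2 P(Y) - V - \<mu>) = \<tau> U\<close> (lemmas \<open>noise_loss_le\<close> and \<open>noise_loss_eq\<close>).

  Lower bound.  The function \<open>h\<close> is a Gaussian convolution, hence differentiable, with
  \<open>\<sigma>\<^sup>2 * h' x = E (P(x + U) U)\<close>; averaging over \<open>X\<close> shows \<open>\<sigma>\<^sup>2 * E h'(X) = A\<close>.  Testing
  efficiency against truncations of \<open>Y\<close> shows \<open>E w(V) \<le> A\<close>: the insider gains at most what the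
  noise traders lose.  The first order condition \<open>v = h x + x * h' x\<close> at \<open>x = \<phi> v\<close> becomes
  \<open>w v = (\<phi> v)\<^sup>2 * h' (\<phi> v)\<close>.  Moreover \<open>w\<close> is convex with subgradient \<open>\<phi>\<close>, being a supremum of
  affine functions of \<open>v\<close>.  Let \<open>f = \<plusminus>sqrt w\<close>, with the sign of \<open>\<phi>\<close>.  Then \<open>f' = \<bar>\<phi>\<bar> / (2 sqrt w)\<close>, so
  that \<open>h' (\<phi> v) = 1 / (4 (f' v)\<^sup>2)\<close> and
    \<open>2 A \<ge> E (\<sigma>\<^sup>2 / (4 f'(V)\<^sup>2) + f(V)\<^sup>2)\<close>.
  Gaussian integration by parts bounds \<open>\<tau>\<^sup>2 * E f'(V)\<close> by \<open>E ((V - \<mu>) f(V))\<close>.  Convexity of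
  \<open>r \<mapsto> 1 / r\<^sup>2\<close> on the first summand and Cauchy-Schwarz on the second turn this into
  \<open>2 A \<ge> \<sigma> * \<tau>\<close>, with equality only when \<open>f\<close> is the linear function \<open>sqrt (\<sigma> / (2 \<tau>)) * (v - \<mu>)\<close>;
  then \<open>w\<close> is a parabola and \<open>\<phi>\<close> is its derivative (lemma \<open>convex_profit_rigidity\<close>).  Jumps
  of \<open>\<phi>\<close> are kinks of the convex function \<open>w\<close>: there are countably many of them, so they do not disturb
  the integrals.

  For the converse, \<open>(V - \<mu>) / \<tau>\<close> and \<open>U / \<sigma>\<close> are exchangeable, which identifies the conditional
  expectation, and the profit against a linear price is a concave parabola in the order.
\<close>

section \<open>Translations of Gaussian integrals\<close>

abbreviation gauss :: "real \<Rightarrow> real \<Rightarrow> real measure" where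
  "gauss m s \<equiv> density lborel (\<lambda>x. ennreal (normal_density m s x))"

text \<open>For Gaussian \<open>N\<close> this class contains the square integrable functions and, unlike that space, is
  stable under translation of the argument.  Efficiency controls \<open>P(x + \<cdot>)\<close> only for almost all orders \<open>x = \<phi> v\<close>,
  whereas the insider may deviate to any order; the translation carries the control over.\<close>

definition exp_integrable :: "real measure \<Rightarrow> (real \<Rightarrow> real) \<Rightarrow> bool" where
  "exp_integrable N g \<longleftrightarrow>
     g \<in> borel_measurable borel \<and> (\<forall>c. integrable N (\<lambda>x. g x * exp (c * \<bar>x\<bar>)))"

lemma integrable_gauss:
  fixes f :: "real \<Rightarrow> real"
  assumes "f \<in> borel_measurable borel"
  shows "integrable (gauss m s) f \<longleftrightarrow> integrable lborel (\<lambda>x. normal_density m s x * f x)"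
  by (subst integrable_density) (use assms in auto)

lemma integral_gauss:
  fixes f :: "real \<Rightarrow> real"
  assumes "f \<in> borel_measurable borel"
  shows "integral\<^sup>L (gauss m s) f = (\<integral>x. normal_density m s x * f x \<partial>lborel)"
  by (subst integral_density) (use assms in auto)

lemma normal_density_shift:
  assumes "s > 0"
  shows "normal_density m s (x - e) =
    normal_density m s x * exp (e * (x - m) / s\<^sup>2 - e\<^sup>2 / (2 * s\<^sup>2))"
proof -
  have "- (x - e - m)\<^sup>2 / (2 * s\<^sup>2)
      = - (x - m)\<^sup>2 / (2 * s\<^sup>2) + (e * (x - m) / s\<^sup>2 - e\<^sup>2 / (2 * s\<^sup>2))"
    using assms by (simp add: field_simps power2_eq_square)
  then show ?thesis
    unfolding normal_density_def by (simp only: exp_add mult.assoc)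
qed

text \<open>Completing the square: multiplying by an exponential only moves the mean, so Gaussian measures
  have exponential moments of every order.\<close>

lemma normal_density_tilt:
  assumes "s > 0"
  shows "normal_density m s x * exp (c * x) =
    exp (c * m + c\<^sup>2 * s\<^sup>2 / 2) * normal_density (m + c * s\<^sup>2) s x"
proof -
  have "c * s\<^sup>2 * (x - m) / s\<^sup>2 - (c * s\<^sup>2)\<^sup>2 / (2 * s\<^sup>2) = c * x - (c * m + c\<^sup>2 * s\<^sup>2 / 2)"
    using assms by (simp add: field_simps power2_eq_square)
  then have "normal_density m s (x - c * s\<^sup>2) =
      normal_density m s x * exp (c * x - (c * m + c\<^sup>2 * s\<^sup>2 / 2))"
    using normal_density_shift[OF assms, of m x "c * s\<^sup>2"] by simp
  moreover have "normal_density m s (x - c * s\<^sup>2) = normal_density (m + c * s\<^sup>2) s x"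
    by (simp add: normal_density_def algebra_simps)
  ultimately show ?thesis
    by (simp add: exp_diff)
qed

lemma integrable_gauss_exp_abs:
  assumes "s > 0"
  shows "integrable (gauss m s) (\<lambda>x. exp (c * \<bar>x\<bar>))"
proof -
  have *: "integrable lborel (\<lambda>x. normal_density m s x * exp (c * x))" for c
    using assms by (subst normal_density_tilt) (auto intro!: integrable_mult_right)
  have "integrable lborel (\<lambda>x. normal_density m s x * exp (c * \<bar>x\<bar>))"
  proof (rule Bochner_Integration.integrable_bound[OF Bochner_Integration.integrable_add[OF *[of c] *[of "-c"]]])
    show "AE x in lborel. norm (normal_density m s x * exp (c * \<bar>x\<bar>))
        \<le> norm (normal_density m s x * exp (c * x) + normal_density m s x * exp (- c * x))"
    proof (rule AE_I2)
      fix x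
      have "normal_density m s x * exp (c * \<bar>x\<bar>)
          \<le> normal_density m s x * exp (c * x) + normal_density m s x * exp (- c * x)"
        by (cases "x \<ge> 0") auto
      then show "norm (normal_density m s x * exp (c * \<bar>x\<bar>))
        \<le> norm (normal_density m s x * exp (c * x) + normal_density m s x * exp (- c * x))"
        by simp
    qed
  qed measurable
  then show ?thesis by (subst integrable_gauss) auto
qed

lemma exp_integrable_square:
  assumes "s > 0" and [measurable]: "g \<in> borel_measurable borel"
    and "integrable (gauss m s) (\<lambda>x. (g x)\<^sup>2)"
  shows "exp_integrable (gauss m s) g"
  unfolding exp_integrable_def
proof (intro conjI allI)
  fix c
  show "integrable (gauss m s) (\<lambda>x. g x * exp (c * \<bar>x\<bar>))"
  proof (rule Bochner_Integration.integrable_bound[OF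
        Bochner_Integration.integrable_add[OF assms(3) integrable_gauss_exp_abs[OF assms(1), of _ "2 * c"]]])
    show "AE x in gauss m s. norm (g x * exp (c * \<bar>x\<bar>))
        \<le> norm ((g x)\<^sup>2 + exp (2 * c * \<bar>x\<bar>))"
    proof (rule AE_I2)
      fix x
      have "exp (2 * c * \<bar>x\<bar>) = (exp (c * \<bar>x\<bar>))\<^sup>2"
        by (simp add: power2_eq_square flip: exp_add)
      moreover have "2 * (\<bar>g x\<bar> * exp (c * \<bar>x\<bar>)) \<le> (g x)\<^sup>2 + (exp (c * \<bar>x\<bar>))\<^sup>2"
        using sum_squares_bound[of "\<bar>g x\<bar>" "exp (c * \<bar>x\<bar>)"] by simp
      ultimately show "norm (g x * exp (c * \<bar>x\<bar>)) \<le> norm ((g x)\<^sup>2 + exp (2 * c * \<bar>x\<bar>))"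
        by (simp add: abs_mult) (smt (verit) mult_nonneg_nonneg abs_ge_zero exp_ge_zero)
    qed
  qed auto
qed (use assms in auto)

lemma exp_integrable_mult:
  assumes g: "exp_integrable (gauss m s) g" and [measurable]: "k \<in> borel_measurable borel"
    and bound: "\<And>x. \<bar>k x\<bar> \<le> C * exp (c * \<bar>x\<bar>)"
  shows "integrable (gauss m s) (\<lambda>x. g x * k x)"
proof -
  have [measurable]: "g \<in> borel_measurable borel"
    and int: "integrable (gauss m s) (\<lambda>x. C * (g x * exp (c * \<bar>x\<bar>)))"
    using g by (auto simp: exp_integrable_def)
  show ?thesis
  proof (rule Bochner_Integration.integrable_bound[OF int])
    show "AE x in gauss m s. norm (g x * k x) \<le> norm (C * (g x * exp (c * \<bar>x\<bar>)))"
    proof (rule AE_I2)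
      fix x
      have "\<bar>g x\<bar> * \<bar>k x\<bar> \<le> \<bar>g x\<bar> * (C * exp (c * \<bar>x\<bar>))"
        by (rule mult_left_mono[OF bound]) simp
      also have "\<dots> \<le> \<bar>g x\<bar> * (\<bar>C\<bar> * exp (c * \<bar>x\<bar>))"
        by (intro mult_left_mono mult_right_mono) auto
      finally show "norm (g x * k x) \<le> norm (C * (g x * exp (c * \<bar>x\<bar>)))"
        by (simp add: abs_mult mult_ac)
    qed
  qed auto
qed

text \<open>Moving the argument of the integrand is the same as moving the density, and moving a Gaussian
  density multiplies it by an exponential.  The integrand itself need not be continuous for the
  right-hand side to depend smoothly on \<open>e\<close>.\<close>

lemma gauss_shift:
  assumes "s > 0" and [measurable]: "g \<in> borel_measurable borel"
  shows "integrable (gauss m s) (\<lambda>x. g (x + e)) \<longleftrightarrow>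
      integrable (gauss m s) (\<lambda>x. g x * exp (e * (x - m) / s\<^sup>2 - e\<^sup>2 / (2 * s\<^sup>2)))"
    and "(\<integral>x. g (x + e) \<partial>gauss m s) =
      (\<integral>x. g x * exp (e * (x - m) / s\<^sup>2 - e\<^sup>2 / (2 * s\<^sup>2)) \<partial>gauss m s)"
proof -
  have eq: "normal_density m s (x - e) * g (x - e + e) =
      normal_density m s x * (g x * exp (e * (x - m) / s\<^sup>2 - e\<^sup>2 / (2 * s\<^sup>2)))" for x
    using normal_density_shift[OF assms(1)] by simp
  then have eq': "(\<lambda>x. normal_density m s (- e + 1 * x) * g (- e + 1 * x + e)) =
      (\<lambda>x. normal_density m s x * (g x * exp (e * (x - m) / s\<^sup>2 - e\<^sup>2 / (2 * s\<^sup>2))))"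
    by (auto simp: algebra_simps)
  show "integrable (gauss m s) (\<lambda>x. g (x + e)) \<longleftrightarrow>
      integrable (gauss m s) (\<lambda>x. g x * exp (e * (x - m) / s\<^sup>2 - e\<^sup>2 / (2 * s\<^sup>2)))"
    using lborel_integrable_real_affine_iff[of 1 "\<lambda>x. normal_density m s x * g (x + e)" "-e"]
    unfolding eq' by (simp add: integrable_gauss)
  show "(\<integral>x. g (x + e) \<partial>gauss m s) =
      (\<integral>x. g x * exp (e * (x - m) / s\<^sup>2 - e\<^sup>2 / (2 * s\<^sup>2)) \<partial>gauss m s)"
    using lborel_integral_real_affine[of 1 "\<lambda>x. normal_density m s x * g (x + e)" "-e"]
    unfolding eq' by (simp add: integral_gauss)
qed

lemma exp_integrable_shift:
  assumes "s > 0" and g: "exp_integrable (gauss m s) g"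
  shows "exp_integrable (gauss m s) (\<lambda>x. g (x + e))"
  unfolding exp_integrable_def
proof (intro conjI allI)
  have [measurable]: "g \<in> borel_measurable borel"
    using g by (auto simp: exp_integrable_def)
  show "(\<lambda>x. g (x + e)) \<in> borel_measurable borel" by measurable
  fix c
  define k where "k = (\<lambda>x. exp (c * \<bar>x - e\<bar>) * exp (e * (x - m) / s\<^sup>2 - e\<^sup>2 / (2 * s\<^sup>2)))"
  have "integrable (gauss m s) (\<lambda>x. g x * k x)"
  proof (rule exp_integrable_mult[OF g])
    fix x
    have "c * \<bar>x - e\<bar> \<le> \<bar>c\<bar> * (\<bar>x\<bar> + \<bar>e\<bar>)"
      by (rule mult_mono) auto
    moreover have "e * (x - m) / s\<^sup>2 \<le> (\<bar>e\<bar> * (\<bar>x\<bar> + \<bar>m\<bar>)) / s\<^sup>2"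
    proof (rule divide_right_mono)
      show "e * (x - m) \<le> \<bar>e\<bar> * (\<bar>x\<bar> + \<bar>m\<bar>)"
        by (rule order_trans[OF abs_ge_self]) (auto simp: abs_mult intro!: mult_left_mono)
    qed auto
    moreover have "0 \<le> e\<^sup>2 / (2 * s\<^sup>2)" by simp
    moreover have "\<bar>c\<bar> * (\<bar>x\<bar> + \<bar>e\<bar>) + (\<bar>e\<bar> * (\<bar>x\<bar> + \<bar>m\<bar>)) / s\<^sup>2
        = (\<bar>c\<bar> * \<bar>e\<bar> + \<bar>e\<bar> * \<bar>m\<bar> / s\<^sup>2) + (\<bar>c\<bar> + \<bar>e\<bar> / s\<^sup>2) * \<bar>x\<bar>"
      by (simp add: algebra_simps add_divide_distrib)
    ultimately have "c * \<bar>x - e\<bar> + (e * (x - m) / s\<^sup>2 - e\<^sup>2 / (2 * s\<^sup>2))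
        \<le> (\<bar>c\<bar> * \<bar>e\<bar> + \<bar>e\<bar> * \<bar>m\<bar> / s\<^sup>2) + (\<bar>c\<bar> + \<bar>e\<bar> / s\<^sup>2) * \<bar>x\<bar>"
      by linarith
    then show "\<bar>k x\<bar> \<le> exp (\<bar>c\<bar> * \<bar>e\<bar> + \<bar>e\<bar> * \<bar>m\<bar> / s\<^sup>2) * exp ((\<bar>c\<bar> + \<bar>e\<bar> / s\<^sup>2) * \<bar>x\<bar>)"
      by (simp add: k_def flip: exp_add)
  qed (simp add: k_def)
  then show "integrable (gauss m s) (\<lambda>x. g (x + e) * exp (c * \<bar>x\<bar>))"
    using gauss_shift(1)[OF assms(1), of "\<lambda>x. g x * exp (c * \<bar>x - e\<bar>)" m e]
    by (simp add: k_def mult.assoc)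
qed

lemma abs_exp_minus_one_le: "\<bar>exp t - 1\<bar> \<le> \<bar>t\<bar> * exp \<bar>t\<bar>" for t :: real
proof (cases "t \<ge> 0")
  case True
  have "1 - t \<le> exp (- t)" using exp_ge_add_one_self[of "-t"] by simp
  then have "exp t * (1 - t) \<le> exp t * exp (- t)" by (intro mult_left_mono) auto
  then have "exp t - 1 \<le> t * exp t" by (simp add: algebra_simps flip: exp_add)
  then show ?thesis using True by simp
next
  case False
  have "1 - exp t \<le> - t" using exp_ge_add_one_self[of t] by linarith
  moreover have "exp t \<le> 1" using False by simp
  moreover have "- t * 1 \<le> - t * exp (- t)"
    using False by (intro mult_left_mono) auto
  moreover have "\<bar>exp t - 1\<bar> = 1 - exp t" "\<bar>t\<bar> = - t"
    using False by auto
  ultimately show ?thesis by simp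
qed

text \<open>Differentiate the exponential in \<open>gauss_shift\<close> at \<open>e = 0\<close>.  The difference quotients of
  \<open>exp (t e x)\<close> are bounded by a multiple of an exponential in \<open>\<bar>x\<bar>\<close> as long as \<open>\<bar>e\<bar> \<le> 1\<close>, which is
  a dominating function for exponentially integrable \<open>g\<close>.\<close>

lemma gauss_shift_derivative:
  assumes s: "s > 0" and g: "exp_integrable (gauss m s) g"
  shows "((\<lambda>e. \<integral>x. g (x + e) \<partial>gauss m s) has_real_derivative
      (\<integral>x. g x * (x - m) \<partial>gauss m s) / s\<^sup>2) (at 0)"
proof -
  have [measurable]: "g \<in> borel_measurable borel"
    using g by (auto simp: exp_integrable_def)
  define t where "t = (\<lambda>e x. e * (x - m) / s\<^sup>2 - e\<^sup>2 / (2 * s\<^sup>2))"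
  define q where "q = (\<lambda>e x. (exp (t e x) - 1) / e)"
  define B where "B = (\<lambda>x. ((\<bar>x\<bar> + \<bar>m\<bar> + 1) / s\<^sup>2) * exp ((\<bar>x\<bar> + \<bar>m\<bar> + 1) / s\<^sup>2))"
  have [measurable]: "q e \<in> borel_measurable borel" "t e \<in> borel_measurable borel" for e
    unfolding q_def t_def by measurable
  have intB: "integrable (gauss m s) (\<lambda>x. g x * B x)"
  proof (rule exp_integrable_mult[OF g])
    show "B \<in> borel_measurable borel" unfolding B_def by measurable
    fix x
    let ?y = "(\<bar>x\<bar> + \<bar>m\<bar> + 1) / s\<^sup>2"
    have "?y \<ge> 0" by simp
    have "B x \<le> exp ?y * exp ?y"
      unfolding B_def using exp_ge_add_one_self[of ?y] by (intro mult_right_mono) (linarith, simp)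
    also have "\<dots> = exp (2 * (\<bar>m\<bar> + 1) / s\<^sup>2) * exp (2 / s\<^sup>2 * \<bar>x\<bar>)"
      by (simp add: add_divide_distrib algebra_simps flip: exp_add)
    finally show "\<bar>B x\<bar> \<le> exp (2 * (\<bar>m\<bar> + 1) / s\<^sup>2) * exp (2 / s\<^sup>2 * \<bar>x\<bar>)"
      by (simp add: B_def)
  qed
  have qB: "\<bar>q e x\<bar> \<le> B x" if "\<bar>e\<bar> \<le> 1" for e x
  proof (cases "e = 0")
    case False
    let ?y = "(\<bar>x\<bar> + \<bar>m\<bar> + 1) / s\<^sup>2"
    have "t e x = e * ((x - m - e / 2) / s\<^sup>2)"
      using s by (simp add: t_def field_simps power2_eq_square)
    moreover have "\<bar>(x - m - e / 2) / s\<^sup>2\<bar> \<le> ?y"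
      unfolding abs_divide using that by (auto intro!: divide_right_mono)
    ultimately have 1: "\<bar>t e x\<bar> \<le> \<bar>e\<bar> * ?y"
      by (metis abs_ge_zero abs_mult mult_left_mono)
    have y: "?y \<ge> 0" by simp
    then have 2: "\<bar>t e x\<bar> \<le> ?y"
      using 1 mult_right_mono[OF that y] by simp
    have "\<bar>exp (t e x) - 1\<bar> \<le> \<bar>t e x\<bar> * exp \<bar>t e x\<bar>"
      by (rule abs_exp_minus_one_le)
    also have "\<dots> \<le> (\<bar>e\<bar> * ?y) * exp ?y"
      using 1 2 y by (intro mult_mono) auto
    finally show ?thesis
      using False by (simp add: q_def B_def field_simps)
  qed (simp add: q_def B_def)
  have pointwise: "((\<lambda>e. q e x) \<longlongrightarrow> (x - m) / s\<^sup>2) (at 0)" for x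
  proof -
    have "((\<lambda>e. exp (e * ((x - m) / s\<^sup>2) - e\<^sup>2 * (1 / (2 * s\<^sup>2)))) has_real_derivative
        (x - m) / s\<^sup>2) (at 0)"
      by (rule derivative_eq_intros refl | simp)+
    then have "((\<lambda>e. exp (t e x)) has_real_derivative (x - m) / s\<^sup>2) (at 0)"
      by (simp add: t_def)
    then show ?thesis
      by (simp add: DERIV_def q_def t_def)
  qed
  have Q: "((\<lambda>e. \<integral>x. g x * q e x \<partial>gauss m s) \<longlongrightarrow> (\<integral>x. g x * ((x - m) / s\<^sup>2) \<partial>gauss m s)) (at 0)"
    unfolding tendsto_at_iff_sequentially
  proof (intro allI impI)
    fix X :: "nat \<Rightarrow> real"
    assume X0: "\<forall>i. X i \<in> UNIV - {0}" and X: "X \<longlonglongrightarrow> 0"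
    have "eventually (\<lambda>n. \<bar>X n\<bar> < 1) sequentially"
      using tendstoD[OF X, of 1] by simp
    then obtain n0 where n0: "\<And>n. n \<ge> n0 \<Longrightarrow> \<bar>X n\<bar> < 1"
      by (auto simp: eventually_sequentially)
    have "(\<lambda>n. \<integral>x. g x * q (X (n + n0)) x \<partial>gauss m s)
        \<longlonglongrightarrow> (\<integral>x. g x * ((x - m) / s\<^sup>2) \<partial>gauss m s)"
    proof (rule integral_dominated_convergence[where w="\<lambda>x. \<bar>g x * B x\<bar>"])
      show "integrable (gauss m s) (\<lambda>x. \<bar>g x * B x\<bar>)"
        using intB by (rule integrable_abs)
      show "AE x in gauss m s. (\<lambda>n. g x * q (X (n + n0)) x) \<longlonglongrightarrow> g x * ((x - m) / s\<^sup>2)"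
      proof (intro AE_I2 tendsto_mult tendsto_const)
        fix x
        have "((\<lambda>e. q e x) \<circ> X) \<longlonglongrightarrow> (x - m) / s\<^sup>2"
          using pointwise[of x] X0 X unfolding tendsto_at_iff_sequentially by blast
        then show "(\<lambda>n. q (X (n + n0)) x) \<longlonglongrightarrow> (x - m) / s\<^sup>2"
          by (auto simp: o_def intro: LIMSEQ_ignore_initial_segment)
      qed
      show "AE x in gauss m s. norm (g x * q (X (n + n0)) x) \<le> \<bar>g x * B x\<bar>" for n
      proof (rule AE_I2)
        fix x
        have "\<bar>q (X (n + n0)) x\<bar> \<le> \<bar>B x\<bar>"
          using qB[of "X (n + n0)" x] n0[of "n + n0"] by simp
        then show "norm (g x * q (X (n + n0)) x) \<le> \<bar>g x * B x\<bar>"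
          by (simp add: abs_mult mult_left_mono)
      qed
    qed simp_all
    then show "((\<lambda>e. \<integral>x. g x * q e x \<partial>gauss m s) \<circ> X)
        \<longlonglongrightarrow> (\<integral>x. g x * ((x - m) / s\<^sup>2) \<partial>gauss m s)"
      unfolding o_def by (rule LIMSEQ_offset)
  qed
  have int0: "integrable (gauss m s) g"
    using g unfolding exp_integrable_def by (auto dest!: spec[of _ "0::real"])
  have quotient: "((\<integral>x. g (x + e) \<partial>gauss m s) - (\<integral>x. g (x + 0) \<partial>gauss m s)) / e =
      (\<integral>x. g x * q e x \<partial>gauss m s)" if "e \<noteq> 0" for e
  proof -
    have "integrable (gauss m s) (\<lambda>x. g (x + e) * exp (0 * \<bar>x\<bar>))"
      using exp_integrable_shift[OF s g, of e] unfolding exp_integrable_def by blast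
    then have "integrable (gauss m s) (\<lambda>x. g x * exp (t e x))"
      using gauss_shift(1)[OF s, of g m e] by (simp add: t_def)
    then have "(\<integral>x. g (x + e) \<partial>gauss m s) - (\<integral>x. g (x + 0) \<partial>gauss m s)
        = (\<integral>x. g x * exp (t e x) - g x \<partial>gauss m s)"
      using gauss_shift(2)[OF s, of g m e] int0
      by (simp add: t_def)
    also have "\<dots> = (\<integral>x. e * (g x * q e x) \<partial>gauss m s)"
      using that by (intro Bochner_Integration.integral_cong) (auto simp: q_def field_simps)
    finally show ?thesis
      using that by simp
  qed
  have "((\<lambda>e. ((\<integral>x. g (x + e) \<partial>gauss m s) - (\<integral>x. g (x + 0) \<partial>gauss m s)) / e)
      \<longlongrightarrow> (\<integral>x. g x * ((x - m) / s\<^sup>2) \<partial>gauss m s)) (at 0)"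
    by (rule iffD2[OF LIM_equal Q]) (use quotient in blast)
  then show ?thesis
    by (simp add: DERIV_def)
qed

section \<open>Convex functions and the signed square root\<close>

lemma AE_gauss:
  assumes "s > 0"
  shows "(AE x in gauss m s. Q x) \<longleftrightarrow> (AE x in lborel. Q x)"
  using normal_density_pos[OF assms] by (subst AE_density) auto

lemma open_AE_lborel:
  fixes S :: "real set"
  assumes "open S" "AE x in lborel. x \<notin> S"
  shows "S = {}"
proof (rule ccontr)
  assume "S \<noteq> {}"
  then have "\<not> negligible S"
    using assms(1) by (rule open_not_negligible[rotated])
  moreover have "S \<in> null_sets lborel"
    using assms by (subst AE_iff_null_sets) auto
  ultimately show False
    by (simp add: negligible_iff_null_sets null_sets_completionI)
qed

text \<open>One half of Gaussian integration by parts.  It is an inequality because the derivative of a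
  monotone function does not see its jumps: the difference quotients of \<open>f\<close> are nonnegative, their
  Gaussian integrals converge to the right-hand side by \<open>gauss_shift_derivative\<close>, and Fatou's lemma
  leaves at most that for the integral of the pointwise limit.\<close>

lemma mono_gauss_derivative_le:
  assumes s: "s > 0" and mono: "mono f" and f: "exp_integrable (gauss m s) f"
    and [measurable]: "f' \<in> borel_measurable borel" and nonneg: "\<And>x. f' x \<ge> 0"
    and deriv: "AE x in lborel. (f has_real_derivative f' x) (at x)"
  shows "integrable (gauss m s) f'"
    and "(\<integral>x. f' x \<partial>gauss m s) \<le> (\<integral>x. f x * (x - m) \<partial>gauss m s) / s\<^sup>2"
proof -
  have [measurable]: "f \<in> borel_measurable borel"
    using f by (auto simp: exp_integrable_def)
  define L where "L = (\<integral>x. f x * (x - m) \<partial>gauss m s) / s\<^sup>2"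
  define e :: "nat \<Rightarrow> real" where "e = (\<lambda>n. 1 / Suc n)"
  define d where "d = (\<lambda>n x. (f (x + e n) - f x) / e n)"
  have e_pos: "e n > 0" for n by (simp add: e_def)
  have e_lim: "e \<longlonglongrightarrow> 0"
    using LIMSEQ_inverse_real_of_nat by (simp add: e_def inverse_eq_divide)
  have d_nonneg: "d n x \<ge> 0" for n x
    using mono e_pos[of n] by (auto simp: d_def mono_def intro!: divide_nonneg_pos)
  have [measurable]: "d n \<in> borel_measurable borel" for n
    unfolding d_def by measurable
  have int: "integrable (gauss m s) (\<lambda>x. f (x + c))" for c
    using exp_integrable_shift[OF s f, of c] unfolding exp_integrable_def
    by (auto dest!: spec[of _ "0::real"])
  have int_d: "integrable (gauss m s) (d n)" for n
    unfolding d_def using int[of "e n"] int[of 0] by (intro integrable_divide_zero) auto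
  have "(\<lambda>n. ((\<integral>x. f (x + e n) \<partial>gauss m s) - (\<integral>x. f (x + 0) \<partial>gauss m s)) / (e n)) \<longlonglongrightarrow> L"
  proof -
    have "((\<lambda>c. ((\<integral>x. f (x + c) \<partial>gauss m s) - (\<integral>x. f (x + 0) \<partial>gauss m s)) / c) \<longlongrightarrow> L) (at 0)"
      using gauss_shift_derivative[OF s f] by (simp add: DERIV_def L_def)
    then show ?thesis
      using e_lim e_pos unfolding tendsto_at_iff_sequentially
      by (auto simp: o_def less_imp_neq[symmetric] dest!: spec[of _ e])
  qed
  also have "(\<lambda>n. ((\<integral>x. f (x + e n) \<partial>gauss m s) - (\<integral>x. f (x + 0) \<partial>gauss m s)) / (e n))
      = (\<lambda>n. \<integral>x. d n x \<partial>gauss m s)"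
    unfolding d_def using int[of "e _"] int[of 0] by (auto simp: fun_eq_iff)
  finally have lim: "(\<lambda>n. \<integral>x. d n x \<partial>gauss m s) \<longlonglongrightarrow> L" .
  have L: "L \<ge> 0"
    by (intro LIMSEQ_le_const[OF lim] exI allI impI Bochner_Integration.integral_nonneg d_nonneg)
  have "(\<integral>\<^sup>+x. ennreal (f' x) \<partial>gauss m s) = (\<integral>\<^sup>+x. liminf (\<lambda>n. ennreal (d n x)) \<partial>gauss m s)"
  proof (rule nn_integral_cong_AE)
    show "AE x in gauss m s. ennreal (f' x) = liminf (\<lambda>n. ennreal (d n x))"
      unfolding AE_gauss[OF s] using deriv
    proof eventually_elim
      case (elim x)
      then have "(\<lambda>n. d n x) \<longlonglongrightarrow> f' x"
        using e_lim e_pos unfolding DERIV_def tendsto_at_iff_sequentially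
        by (auto simp: d_def o_def less_imp_neq[symmetric] dest!: spec[of _ e])
      then have "(\<lambda>n. ennreal (d n x)) \<longlonglongrightarrow> ennreal (f' x)"
        by (rule tendsto_ennrealI)
      then show ?case
        by (simp add: lim_imp_Liminf)
    qed
  qed
  also have "\<dots> \<le> liminf (\<lambda>n. \<integral>\<^sup>+x. ennreal (d n x) \<partial>gauss m s)"
    by (rule nn_integral_liminf) measurable
  also have "\<dots> = liminf (\<lambda>n. ennreal (\<integral>x. d n x \<partial>gauss m s))"
    using int_d d_nonneg by (simp add: nn_integral_eq_integral)
  also have "\<dots> = ennreal L"
    using tendsto_ennrealI[OF lim] by (simp add: lim_imp_Liminf)
  finally have *: "(\<integral>\<^sup>+x. ennreal (f' x) \<partial>gauss m s) \<le> ennreal L" .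
  then show "integrable (gauss m s) f'"
    using nonneg by (intro integrableI_nonneg) (auto simp: top_unique intro: le_less_trans)
  show "(\<integral>x. f' x \<partial>gauss m s) \<le> (\<integral>x. f x * (x - m) \<partial>gauss m s) / s\<^sup>2"
    using * L nonneg
    by (subst integral_eq_nn_integral) (auto simp: L_def[symmetric] intro: enn2real_leI)
qed

lemma subgradient_continuous:
  fixes w \<phi> :: "real \<Rightarrow> real"
  assumes sub: "\<And>v v'. w v + \<phi> v * (v' - v) \<le> w v'"
  shows "continuous_on UNIV w"
proof (rule convex_on_continuous)
  show "convex_on UNIV w"
  proof (rule convex_onI)
    fix t x y :: real
    assume t: "0 < t" "t < 1"
    let ?z = "(1 - t) *\<^sub>R x + t *\<^sub>R y"
    have "(1 - t) * (w ?z + \<phi> ?z * (x - ?z)) + t * (w ?z + \<phi> ?z * (y - ?z)) \<le> (1 - t) * w x + t * w y"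
      using t by (intro add_mono mult_left_mono sub) auto
    also have "(1 - t) * (w ?z + \<phi> ?z * (x - ?z)) + t * (w ?z + \<phi> ?z * (y - ?z)) = w ?z"
      by (simp add: algebra_simps)
    finally show "w ?z \<le> (1 - t) * w x + t * w y" .
  qed simp
qed simp

lemma subgradient_mono:
  fixes w \<phi> :: "real \<Rightarrow> real"
  assumes sub: "\<And>v v'. w v + \<phi> v * (v' - v) \<le> w v'"
  shows "mono \<phi>"
proof (rule monoI)
  fix u v :: real
  assume "u \<le> v"
  show "\<phi> u \<le> \<phi> v"
  proof (cases "u = v")
    case False
    have "(\<phi> v - \<phi> u) * (v - u) \<ge> 0"
      using sub[of u v] sub[of v u] by (simp add: algebra_simps)
    then show ?thesis
      using False \<open>u \<le> v\<close> by (auto simp: zero_le_mult_iff)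
  qed simp
qed

text \<open>The difference quotient of \<open>w\<close> between \<open>v\<close> and \<open>v + h\<close> lies between \<open>\<phi> v\<close> and \<open>\<phi> (v + h)\<close>.\<close>

lemma subgradient_derivative:
  fixes w \<phi> :: "real \<Rightarrow> real"
  assumes sub: "\<And>v v'. w v + \<phi> v * (v' - v) \<le> w v'" and cont: "isCont \<phi> v"
  shows "(w has_real_derivative \<phi> v) (at v)"
proof -
  have lim: "((\<lambda>h. \<phi> (v + h)) \<longlongrightarrow> \<phi> v) (at 0)"
    using cont by (simp add: isCont_def LIM_offset_zero)
  have "((\<lambda>h. (w (v + h) - w v) / h - \<phi> v) \<longlongrightarrow> 0) (at 0)"
  proof (rule Lim_null_comparison)
    show "((\<lambda>h. \<bar>\<phi> (v + h) - \<phi> v\<bar>) \<longlongrightarrow> 0) (at 0)"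
      using lim by (intro tendsto_rabs_zero) (simp add: LIM_zero)
    show "\<forall>\<^sub>F h in at 0. norm ((w (v + h) - w v) / h - \<phi> v) \<le> \<bar>\<phi> (v + h) - \<phi> v\<bar>"
      unfolding eventually_at_filter
    proof (rule always_eventually, intro allI impI)
      fix h :: real
      assume h: "h \<noteq> 0"
      have "\<phi> v * h \<le> w (v + h) - w v" "w (v + h) - w v \<le> \<phi> (v + h) * h"
        using sub[of v "v + h"] sub[of "v + h" v] by (auto simp: algebra_simps)
      then have "\<bar>w (v + h) - w v - \<phi> v * h\<bar> \<le> \<bar>(\<phi> (v + h) - \<phi> v) * h\<bar>"
        by (simp add: algebra_simps)
      moreover have "(w (v + h) - w v) / h - \<phi> v = (w (v + h) - w v - \<phi> v * h) / h"
        using h by (simp add: field_simps)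
      ultimately show "norm ((w (v + h) - w v) / h - \<phi> v) \<le> \<bar>\<phi> (v + h) - \<phi> v\<bar>"
        using h by (simp add: abs_mult divide_le_eq)
    qed
  qed
  then show ?thesis
    by (simp add: DERIV_def LIM_zero_cancel)
qed


text \<open>Giving the square root the sign of the subgradient makes it increasing across the minimum point
  \<open>v1\<close>; it jumps there if the minimum of \<open>w\<close> is positive.  Away from \<open>v1\<close>, positivity of \<open>w\<close> comes from the
  supporting line at the midpoint of \<open>v\<close> and \<open>v1\<close>.  A monotone subgradient is discontinuous at
  countably many points only, so the chain rule applies almost everywhere.\<close>

lemma sqrt_convex_derivative:
  fixes w \<phi> :: "real \<Rightarrow> real"
  assumes sub: "\<And>v v'. w v + \<phi> v * (v' - v) \<le> w v'"
    and neg: "\<And>v. v < v1 \<Longrightarrow> \<phi> v < 0" and pos: "\<And>v. v > v1 \<Longrightarrow> \<phi> v > 0"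
    and w_nonneg: "\<And>v. w v \<ge> 0"
  defines "f \<equiv> \<lambda>v. sgn (v - v1) * sqrt (w v)"
  shows "v \<noteq> v1 \<Longrightarrow> w v > 0"
    and "mono f"
    and "AE v in lborel. (f has_real_derivative \<bar>\<phi> v\<bar> / (2 * sqrt (w v))) (at v)"
proof -
  have w_pos: "w v > 0" if "v \<noteq> v1" for v
  proof (cases "v > v1")
    case True
    let ?u = "(v + v1) / 2"
    have "\<phi> ?u * (v - ?u) > 0"
      using True by (intro mult_pos_pos pos) auto
    then show ?thesis
      using sub[of ?u v] w_nonneg[of ?u] by linarith
  next
    case False
    let ?u = "(v + v1) / 2"
    have "\<phi> ?u * (v - ?u) > 0"
      using False that by (intro mult_neg_neg neg) auto
    then show ?thesis
      using sub[of ?u v] w_nonneg[of ?u] by linarith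
  qed
  then show "v \<noteq> v1 \<Longrightarrow> w v > 0" .
  show "mono f"
  proof (rule monoI)
    fix u v :: real
    assume uv: "u \<le> v"
    consider "u > v1" | "v < v1" | "u \<le> v1" "v1 \<le> v" by linarith
    then show "f u \<le> f v"
    proof cases
      case 1
      have "\<phi> u * (v - u) \<ge> 0" using uv pos[OF 1] by simp
      then show ?thesis using sub[of u v] 1 uv by (simp add: f_def)
    next
      case 2
      have "\<phi> v * (u - v) \<ge> 0" using uv neg[OF 2] by (simp add: mult_nonpos_nonpos)
      then show ?thesis using sub[of v u] 2 uv by (simp add: f_def)
    next
      case 3
      have "f u \<le> 0" "0 \<le> f v"
        using 3 w_nonneg by (auto simp: f_def sgn_if)
      then show ?thesis by simp
    qed
  qed
  have "countable {v. \<not> isCont \<phi> v}"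
    by (rule mono_ctble_discont[OF subgradient_mono[OF sub]])
  then have "countable (insert v1 {v. \<not> isCont \<phi> v})"
    by simp
  then have "AE v in lborel. v \<notin> insert v1 {v. \<not> isCont \<phi> v}"
    by (intro AE_not_in countable_imp_null_set_lborel)
  then show "AE v in lborel. (f has_real_derivative \<bar>\<phi> v\<bar> / (2 * sqrt (w v))) (at v)"
  proof eventually_elim
    case (elim v)
    then have v: "v \<noteq> v1" "isCont \<phi> v" by auto
    have "((\<lambda>x. sgn (v - v1) * sqrt (w x)) has_real_derivative
        sgn (v - v1) * (\<phi> v * (inverse (sqrt (w v)) / 2))) (at v)"
      using subgradient_derivative[OF sub v(2)] w_pos[OF v(1)]
      by (auto intro!: derivative_eq_intros)
    also have "sgn (v - v1) * (\<phi> v * (inverse (sqrt (w v)) / 2)) = \<bar>\<phi> v\<bar> / (2 * sqrt (w v))"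
      using v(1) neg[of v] pos[of v] by (cases "v > v1") (auto simp: field_simps sgn_if)
    finally show ?case
    proof (rule has_field_derivative_transform_within_open)
      show "open (if v > v1 then {v1<..} else {..<v1})" by simp
      show "v \<in> (if v > v1 then {v1<..} else {..<v1})" using v by auto
    qed (use v(1) in \<open>auto simp: f_def sgn_if split: if_splits\<close>)
  qed
qed

text \<open>With \<open>f\<close> the signed square root of \<open>w\<close> and \<open>d\<close> its derivative, \<open>H = 1 / (4 * d\<^sup>2)\<close>.  The function
  \<open>D\<close> below is \<open>\<sigma>\<^sup>2 * H + w\<close> minus its lower bound: with \<open>a = sqrt (\<sigma> / (2 * \<tau>))\<close>, which is the
  slope of \<open>f\<close> in the linear equilibrium, and \<open>r = d / a\<close>, the convex term \<open>\<sigma>\<^sup>2 * H\<close> exceeds its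
  tangent at \<open>r = 1\<close> by a positive multiple of \<open>(r - 1)\<^sup>2\<close>, and \<open>w = f\<^sup>2\<close> exceeds
  \<open>2 * a * (v - \<mu>) * f - a\<^sup>2 * (v - \<mu>)\<^sup>2\<close> by a square.  So \<open>D\<close> is nonnegative, while integration by
  parts makes the joint contribution of its terms in \<open>d\<close> and \<open>f\<close> to its integral nonpositive, which
  leaves an integral of at most zero.  Hence \<open>D\<close>
  vanishes almost everywhere and \<open>f\<close> is linear.\<close>

lemma convex_profit_rigidity:
  fixes w \<phi> H :: "real \<Rightarrow> real"
  assumes t: "\<tau> > 0" and s: "\<sigma> > 0"
    and sub: "\<And>v v'. w v + \<phi> v * (v' - v) \<le> w v'"
    and foc: "\<And>v. w v = (\<phi> v)\<^sup>2 * H v"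
    and neg: "\<And>v. v < v1 \<Longrightarrow> \<phi> v < 0" and pos: "\<And>v. v > v1 \<Longrightarrow> \<phi> v > 0"
    and w_nonneg: "\<And>v. w v \<ge> 0"
    and int_w: "integrable (gauss \<mu> \<tau>) w" and int_H: "integrable (gauss \<mu> \<tau>) H"
    and bound: "\<sigma>\<^sup>2 * (\<integral>v. H v \<partial>gauss \<mu> \<tau>) + (\<integral>v. w v \<partial>gauss \<mu> \<tau>) \<le> \<sigma> * \<tau>"
  shows "\<phi> v = \<sigma> / \<tau> * (v - \<mu>)"
    and "\<sigma>\<^sup>2 * (\<integral>v. H v \<partial>gauss \<mu> \<tau>) + (\<integral>v. w v \<partial>gauss \<mu> \<tau>) = \<sigma> * \<tau>"
proof -
  interpret N: prob_space "gauss \<mu> \<tau>"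
    by (rule prob_space_normal_density[OF t])
  define a where "a = sqrt (\<sigma> / (2 * \<tau>))"
  have a: "a > 0" "a\<^sup>2 = \<sigma> / (2 * \<tau>)"
    using s t by (auto simp: a_def)
  define f where "f = (\<lambda>v. sgn (v - v1) * sqrt (w v))"
  define d where "d = (\<lambda>v. \<bar>\<phi> v\<bar> / (2 * sqrt (w v)))"
  have w_pos: "w v > 0" if "v \<noteq> v1" for v
    using sub neg pos w_nonneg that by (rule sqrt_convex_derivative(1))
  have f_mono: "mono f"
    unfolding f_def using sub neg pos w_nonneg by (rule sqrt_convex_derivative(2))
  have f_deriv: "AE v in lborel. (f has_real_derivative d v) (at v)"
    unfolding f_def d_def using sub neg pos w_nonneg by (rule sqrt_convex_derivative(3))
  have [measurable]: "w \<in> borel_measurable borel" "H \<in> borel_measurable borel"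
    using int_w int_H by (auto dest: borel_measurable_integrable)
  have [measurable]: "\<phi> \<in> borel_measurable borel"
    by (rule borel_measurable_mono[OF subgradient_mono[OF sub]])
  have [measurable]: "f \<in> borel_measurable borel"
    by (rule borel_measurable_mono[OF f_mono])
  have [measurable]: "d \<in> borel_measurable borel"
    unfolding d_def by measurable
  have ne: "AE v in gauss \<mu> \<tau>. v \<noteq> v1"
    unfolding AE_gauss[OF t] by (rule AE_lborel_singleton)
  have f_sq: "(f v)\<^sup>2 = w v" if "v \<noteq> v1" for v
    using that w_nonneg[of v] by (simp add: f_def power_mult_distrib sgn_if)
  have int_fsq: "integrable (gauss \<mu> \<tau>) (\<lambda>v. (f v)\<^sup>2)"
    using ne f_sq by (intro integrable_cong_AE_imp[OF int_w]) (auto elim: eventually_mono)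
  have f: "exp_integrable (gauss \<mu> \<tau>) f"
    by (rule exp_integrable_square[OF t _ int_fsq]) measurable
  have d: "integrable (gauss \<mu> \<tau>) d"
      "(\<integral>v. d v \<partial>gauss \<mu> \<tau>) \<le> (\<integral>v. f v * (v - \<mu>) \<partial>gauss \<mu> \<tau>) / \<tau>\<^sup>2"
    using mono_gauss_derivative_le[OF t f_mono f _ _ f_deriv] by (auto simp: d_def w_nonneg)
  have int_f: "integrable (gauss \<mu> \<tau>) (\<lambda>v. f v * (v - \<mu>))"
  proof (rule exp_integrable_mult[OF f])
    fix x :: real
    have "0 \<le> \<bar>\<mu>\<bar> * \<bar>x\<bar>" by simp
    then have "\<bar>x - \<mu>\<bar> \<le> (1 + \<bar>\<mu>\<bar>) * (1 + \<bar>x\<bar>)"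
      using abs_triangle_ineq4[of x \<mu>] unfolding distrib_left distrib_right mult_1_right mult_1
      by linarith
    also have "\<dots> \<le> (1 + \<bar>\<mu>\<bar>) * exp (1 * \<bar>x\<bar>)"
      by (intro mult_left_mono) auto
    finally show "\<bar>x - \<mu>\<bar> \<le> (1 + \<bar>\<mu>\<bar>) * exp (1 * \<bar>x\<bar>)" .
  qed simp
  have var: "integrable (gauss \<mu> \<tau>) (\<lambda>v. (v - \<mu>)\<^sup>2)" "(\<integral>v. (v - \<mu>)\<^sup>2 \<partial>gauss \<mu> \<tau>) = \<tau>\<^sup>2"
    using integrable_normal_moment[OF t, of \<mu> 2] integral_normal_moment_even[OF t, of \<mu> 1] t
    by (auto simp: integrable_gauss integral_gauss)
  define D where "D = (\<lambda>v. \<sigma>\<^sup>2 * H v + w v - 3 * \<sigma> * \<tau> / 2 + a\<^sup>2 * (v - \<mu>)\<^sup>2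
      + 2 * a * \<tau>\<^sup>2 * d v - 2 * a * (f v * (v - \<mu>)))"
  have D_eq: "D v = (f v - a * (v - \<mu>))\<^sup>2 + \<sigma> * \<tau> * ((r - 1)\<^sup>2 * (2 * r + 1) / (2 * r\<^sup>2))"
    and r_pos: "r > 0"
    if v: "v \<noteq> v1" and r_def: "r = d v / a" for v r
  proof -
    have phi: "\<phi> v \<noteq> 0" using v neg[of v] pos[of v] by (cases "v < v1") auto
    have w: "w v > 0" by (rule w_pos[OF v])
    show r: "r > 0" using phi w a by (simp add: r_def d_def)
    have d: "d v = a * r" using a by (simp add: r_def)
    have "(d v)\<^sup>2 = (\<phi> v)\<^sup>2 / (4 * w v)"
      using w by (simp add: d_def power_divide power_mult_distrib)
    then have H_d: "H v = 1 / (4 * (d v)\<^sup>2)"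
      using foc[of v] phi w by simp
    have "4 * (d v)\<^sup>2 = 2 * \<sigma> / \<tau> * r\<^sup>2"
      unfolding d power_mult_distrib a(2) by simp
    then have H: "\<sigma>\<^sup>2 * H v = \<sigma> * \<tau> / (2 * r\<^sup>2)"
      using s by (simp add: H_d power2_eq_square)
    have d': "2 * a * \<tau>\<^sup>2 * d v = \<sigma> * \<tau> * r"
    proof -
      have "2 * a * \<tau>\<^sup>2 * d v = 2 * a\<^sup>2 * \<tau>\<^sup>2 * r"
        by (simp add: d power2_eq_square)
      also have "2 * a\<^sup>2 * \<tau>\<^sup>2 = \<sigma> * \<tau>"
        unfolding a(2) using t by (simp add: power2_eq_square)
      finally show ?thesis .
    qed
    have "(r - 1)\<^sup>2 * (2 * r + 1) = 1 - 3 * r\<^sup>2 + 2 * r\<^sup>2 * r"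
      by (simp add: power2_eq_square algebra_simps)
    then have "(r - 1)\<^sup>2 * (2 * r + 1) / (2 * r\<^sup>2) = 1 / (2 * r\<^sup>2) - 3 / 2 + r"
      using r by (simp add: add_divide_distrib diff_divide_distrib)
    note square = this
    have "\<sigma> * \<tau> / (2 * r\<^sup>2) - 3 * \<sigma> * \<tau> / 2 + \<sigma> * \<tau> * r
        = \<sigma> * \<tau> * ((r - 1)\<^sup>2 * (2 * r + 1) / (2 * r\<^sup>2))"
      unfolding square by (simp add: right_diff_distrib distrib_left)
    moreover have "(f v - a * (v - \<mu>))\<^sup>2
        = w v + a\<^sup>2 * (v - \<mu>)\<^sup>2 - 2 * a * (f v * (v - \<mu>))"
      unfolding power2_diff power_mult_distrib f_sq[OF v] by simp
    ultimately show "D v = (f v - a * (v - \<mu>))\<^sup>2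
        + \<sigma> * \<tau> * ((r - 1)\<^sup>2 * (2 * r + 1) / (2 * r\<^sup>2))"
      unfolding D_def H d' by linarith
  qed
  have D_ge: "D v \<ge> (f v - a * (v - \<mu>))\<^sup>2" if "v \<noteq> v1" for v
    using D_eq[OF that refl] r_pos[OF that refl] s t by simp
  have int_D: "integrable (gauss \<mu> \<tau>) D"
    unfolding D_def using int_H int_w var(1) d(1) int_f by simp
  have "(\<integral>v. D v \<partial>gauss \<mu> \<tau>) = \<sigma>\<^sup>2 * (\<integral>v. H v \<partial>gauss \<mu> \<tau>) + (\<integral>v. w v \<partial>gauss \<mu> \<tau>)
      - 3 * \<sigma> * \<tau> / 2 + a\<^sup>2 * \<tau>\<^sup>2 + 2 * a * \<tau>\<^sup>2 * (\<integral>v. d v \<partial>gauss \<mu> \<tau>)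
      - 2 * a * (\<integral>v. f v * (v - \<mu>) \<partial>gauss \<mu> \<tau>)"
    unfolding D_def using int_H int_w var d(1) int_f N.prob_space by simp
  also have "\<dots> \<le> \<sigma>\<^sup>2 * (\<integral>v. H v \<partial>gauss \<mu> \<tau>) + (\<integral>v. w v \<partial>gauss \<mu> \<tau>) - \<sigma> * \<tau>"
  proof -
    have "a\<^sup>2 * \<tau>\<^sup>2 = \<sigma> * \<tau> / 2" unfolding a(2) using t by (simp add: power2_eq_square)
    moreover have "2 * a * \<tau>\<^sup>2 * (\<integral>v. d v \<partial>gauss \<mu> \<tau>)
        \<le> 2 * a * \<tau>\<^sup>2 * ((\<integral>v. f v * (v - \<mu>) \<partial>gauss \<mu> \<tau>) / \<tau>\<^sup>2)"
      using d(2) a t by (intro mult_left_mono) auto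
    ultimately show ?thesis using t by simp
  qed
  finally have D_le: "(\<integral>v. D v \<partial>gauss \<mu> \<tau>) \<le>
      \<sigma>\<^sup>2 * (\<integral>v. H v \<partial>gauss \<mu> \<tau>) + (\<integral>v. w v \<partial>gauss \<mu> \<tau>) - \<sigma> * \<tau>" .
  have D_nonneg: "AE v in gauss \<mu> \<tau>. 0 \<le> D v"
    using ne
  proof eventually_elim
    case (elim v)
    show ?case by (rule order_trans[OF zero_le_power2 D_ge[OF elim]])
  qed
  then have "(\<integral>v. D v \<partial>gauss \<mu> \<tau>) \<ge> 0"
    by (rule integral_nonneg_AE)
  with D_le bound show "\<sigma>\<^sup>2 * (\<integral>v. H v \<partial>gauss \<mu> \<tau>) + (\<integral>v. w v \<partial>gauss \<mu> \<tau>) = \<sigma> * \<tau>"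
    by linarith
  have "(\<integral>v. D v \<partial>gauss \<mu> \<tau>) = 0"
    using D_le bound \<open>(\<integral>v. D v \<partial>gauss \<mu> \<tau>) \<ge> 0\<close> by linarith
  then have "AE v in gauss \<mu> \<tau>. D v = 0"
    using integral_nonneg_eq_0_iff_AE[OF int_D D_nonneg] by simp
  then have "AE v in gauss \<mu> \<tau>. w v = a\<^sup>2 * (v - \<mu>)\<^sup>2"
    using ne
  proof eventually_elim
    case (elim v)
    then have "f v = a * (v - \<mu>)"
      using D_ge[of v] by simp
    then show ?case
      using f_sq[of v] elim by (simp add: power_mult_distrib)
  qed
  then have ae: "AE v in lborel. v \<notin> {v. w v \<noteq> a\<^sup>2 * (v - \<mu>)\<^sup>2}"
    unfolding AE_gauss[OF t] by simp
  have "open {v. w v \<noteq> a\<^sup>2 * (v - \<mu>)\<^sup>2}"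
    using subgradient_continuous[OF sub]
    by (intro open_Collect_neq continuous_intros) auto
  from open_AE_lborel[OF this ae] have w_eq: "w v = a\<^sup>2 * (v - \<mu>)\<^sup>2" for v
    by blast
  show "\<phi> v = \<sigma> / \<tau> * (v - \<mu>)"
  proof -
    define c where "c = \<phi> v - 2 * a\<^sup>2 * (v - \<mu>)"
    have "c * h \<le> a\<^sup>2 * h\<^sup>2" for h
      using sub[of v "v + h"] by (simp add: w_eq c_def algebra_simps power2_eq_square)
    \<comment> \<open>this \<open>h\<close> maximises \<open>c * h - a\<^sup>2 * h\<^sup>2\<close>, with maximum \<open>c\<^sup>2 / (4 * a\<^sup>2)\<close>\<close>
    from this[of "c / (2 * a\<^sup>2)"] have "c\<^sup>2 \<le> 0"
      using a(1) by (simp add: field_simps power2_eq_square)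
    then have "c = 0" by simp
    then show ?thesis
      by (simp add: c_def a)
  qed
qed

section \<open>The market with independent Gaussian value and noise\<close>

lemma integrable_mult_square:
  fixes f g :: "'a \<Rightarrow> real"
  assumes [measurable]: "f \<in> borel_measurable M" "g \<in> borel_measurable M"
    and "integrable M (\<lambda>\<omega>. (f \<omega>)\<^sup>2)" "integrable M (\<lambda>\<omega>. (g \<omega>)\<^sup>2)"
  shows "integrable M (\<lambda>\<omega>. f \<omega> * g \<omega>)"
proof (rule Bochner_Integration.integrable_bound[OF Bochner_Integration.integrable_add[OF assms(3,4)]])
  show "AE \<omega> in M. norm (f \<omega> * g \<omega>) \<le> norm ((f \<omega>)\<^sup>2 + (g \<omega>)\<^sup>2)"
  proof (rule AE_I2)
    fix \<omega>
    have "2 * (\<bar>f \<omega>\<bar> * \<bar>g \<omega>\<bar>) \<le> (f \<omega>)\<^sup>2 + (g \<omega>)\<^sup>2"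
      using sum_squares_bound[of "\<bar>f \<omega>\<bar>" "\<bar>g \<omega>\<bar>"] by simp
    moreover have "0 \<le> \<bar>f \<omega>\<bar> * \<bar>g \<omega>\<bar>" by simp
    ultimately have "\<bar>f \<omega>\<bar> * \<bar>g \<omega>\<bar> \<le> \<bar>(f \<omega>)\<^sup>2 + (g \<omega>)\<^sup>2\<bar>" by linarith
    then show "norm (f \<omega> * g \<omega>) \<le> norm ((f \<omega>)\<^sup>2 + (g \<omega>)\<^sup>2)"
      by (simp add: abs_mult)
  qed
qed measurable

text \<open>Efficiency may only be tested against functions of \<open>Y\<close> whose product with \<open>V\<close> is integrable.  The
  natural test function \<open>Y\<close> itself is not known to qualify, as \<open>\<phi> V\<close> is not known to be integrable.
  The truncations are bounded, odd, monotone and 1-Lipschitz, so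
  that their Gaussian means keep the sign of the order and stay within \<open>E \<bar>U\<bar>\<close> of the truncation.\<close>

definition clip :: "nat \<Rightarrow> real \<Rightarrow> real" where
  "clip n y = max (- real n) (min (real n) y)"

lemma clip_measurable [measurable]: "clip n \<in> borel_measurable borel"
  unfolding clip_def by measurable

lemma clip_bounds: "\<bar>clip n y\<bar> \<le> real n" "\<bar>clip n y\<bar> \<le> \<bar>y\<bar>" "\<bar>clip n y - clip n x\<bar> \<le> \<bar>y - x\<bar>"
  by (auto simp: clip_def)

lemma clip_tendsto: "(\<lambda>n. clip n y) \<longlonglongrightarrow> y"
proof (rule tendsto_eventually)
  obtain n0 :: nat where "\<bar>y\<bar> \<le> real n0"
    using real_arch_simple by blast
  then show "\<forall>\<^sub>F n in sequentially. clip n y = y"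
    by (intro eventually_sequentiallyI[of n0]) (auto simp: clip_def)
qed

locale gaussian_market = prob_space M
  for M :: "'a measure" +
  fixes V U :: "'a \<Rightarrow> real" and \<mu> \<tau> \<sigma> :: real
  assumes tau: "\<tau> > 0" and sigma: "\<sigma> > 0"
    and distr_V: "distributed M lborel V (normal_density \<mu> \<tau>)"
    and distr_U: "distributed M lborel U (normal_density 0 \<sigma>)"
    and indep: "indep_var borel V borel U"
begin

abbreviation "value_law \<equiv> gauss \<mu> \<tau>"
abbreviation "noise_law \<equiv> gauss 0 \<sigma>"

sublocale valuation: prob_space value_law
  by (rule prob_space_normal_density[OF tau])

sublocale noise: prob_space noise_law
  by (rule prob_space_normal_density[OF sigma])

sublocale pair: pair_prob_space value_law noise_law ..

lemma V_measurable [measurable]: "V \<in> borel_measurable M"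
  using distributed_measurable[OF distr_V] by simp

lemma U_measurable [measurable]: "U \<in> borel_measurable M"
  using distributed_measurable[OF distr_U] by simp

lemma law_V: "distr M borel V = value_law"
  using distributed_distr_eq_density[OF distr_V] by (simp cong: distr_cong)

lemma law_U: "distr M borel U = noise_law"
  using distributed_distr_eq_density[OF distr_U] by (simp cong: distr_cong)

lemma joint_law: "distr M (borel \<Otimes>\<^sub>M borel) (\<lambda>\<omega>. (V \<omega>, U \<omega>)) = value_law \<Otimes>\<^sub>M noise_law"
  using indep unfolding indep_var_distribution_eq law_V law_U by simp

lemma integrable_joint:
  fixes F :: "real \<times> real \<Rightarrow> real"
  assumes [measurable]: "F \<in> borel_measurable (borel \<Otimes>\<^sub>M borel)"
  shows "integrable (value_law \<Otimes>\<^sub>M noise_law) F \<longleftrightarrow> integrable M (\<lambda>\<omega>. F (V \<omega>, U \<omega>))"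
  unfolding joint_law[symmetric] by (subst integrable_distr_eq) simp_all

lemma integral_joint:
  fixes F :: "real \<times> real \<Rightarrow> real"
  assumes [measurable]: "F \<in> borel_measurable (borel \<Otimes>\<^sub>M borel)"
  shows "(\<integral>z. F z \<partial>(value_law \<Otimes>\<^sub>M noise_law)) = (\<integral>\<omega>. F (V \<omega>, U \<omega>) \<partial>M)"
  unfolding joint_law[symmetric] by (subst integral_distr) simp_all

lemma AE_joint:
  assumes [measurable]: "Measurable.pred (borel \<Otimes>\<^sub>M borel) Q" and "AE \<omega> in M. Q (V \<omega>, U \<omega>)"
  shows "AE v in value_law. AE u in noise_law. Q (v, u)"
proof -
  have "AE z in value_law \<Otimes>\<^sub>M noise_law. Q z"
    unfolding joint_law[symmetric] using assms by (subst AE_distr_iff) simp_all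
  then show ?thesis
    by (rule pair.AE_pair)
qed

lemma disintegrate_noise:
  fixes F :: "real \<times> real \<Rightarrow> real"
  assumes [measurable]: "F \<in> borel_measurable (borel \<Otimes>\<^sub>M borel)"
    and int: "integrable M (\<lambda>\<omega>. F (V \<omega>, U \<omega>))"
  shows "integrable value_law (\<lambda>v. \<integral>u. F (v, u) \<partial>noise_law)"
    and "(\<integral>v. \<integral>u. F (v, u) \<partial>noise_law \<partial>value_law) = (\<integral>\<omega>. F (V \<omega>, U \<omega>) \<partial>M)"
    and "AE v in value_law. integrable noise_law (\<lambda>u. F (v, u))"
proof -
  have "integrable (value_law \<Otimes>\<^sub>M noise_law) F"
    using int by (simp add: integrable_joint)
  note * = pair.integrable_fst'[OF this] pair.integral_fst'[OF this] pair.AE_integrable_fst'[OF this]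
  from * show "integrable value_law (\<lambda>v. \<integral>u. F (v, u) \<partial>noise_law)"
    "(\<integral>v. \<integral>u. F (v, u) \<partial>noise_law \<partial>value_law) = (\<integral>\<omega>. F (V \<omega>, U \<omega>) \<partial>M)"
    "AE v in value_law. integrable noise_law (\<lambda>u. F (v, u))"
    by (simp_all add: integral_joint)
qed

lemma integrable_value:
  fixes g :: "real \<Rightarrow> real"
  assumes [measurable]: "g \<in> borel_measurable borel"
  shows "integrable M (\<lambda>\<omega>. g (V \<omega>)) \<longleftrightarrow> integrable value_law g"
  unfolding law_V[symmetric] by (subst integrable_distr_eq) simp_all

lemma integral_value:
  fixes g :: "real \<Rightarrow> real"
  assumes [measurable]: "g \<in> borel_measurable borel"
  shows "(\<integral>\<omega>. g (V \<omega>) \<partial>M) = (\<integral>v. g v \<partial>value_law)"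
  unfolding law_V[symmetric] by (subst integral_distr) simp_all

lemma integrable_noise:
  fixes g :: "real \<Rightarrow> real"
  assumes [measurable]: "g \<in> borel_measurable borel"
  shows "integrable M (\<lambda>\<omega>. g (U \<omega>)) \<longleftrightarrow> integrable noise_law g"
  unfolding law_U[symmetric] by (subst integrable_distr_eq) simp_all

lemma integral_noise:
  fixes g :: "real \<Rightarrow> real"
  assumes [measurable]: "g \<in> borel_measurable borel"
  shows "(\<integral>\<omega>. g (U \<omega>) \<partial>M) = (\<integral>u. g u \<partial>noise_law)"
  unfolding law_U[symmetric] by (subst integral_distr) simp_all

lemma value_moments:
  "integrable M V" "(\<integral>\<omega>. V \<omega> \<partial>M) = \<mu>"
  "integrable M (\<lambda>\<omega>. (V \<omega>)\<^sup>2)"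
  "integrable M (\<lambda>\<omega>. (V \<omega> - \<mu>)\<^sup>2)" "(\<integral>\<omega>. (V \<omega> - \<mu>)\<^sup>2 \<partial>M) = \<tau>\<^sup>2"
proof -
  show *: "integrable M V" "(\<integral>\<omega>. V \<omega> \<partial>M) = \<mu>"
    using integrable_normal_moment_nz_1[OF tau] integral_normal_moment_nz_1[OF tau]
      integrable_value[of "\<lambda>v. v"] integral_value[of "\<lambda>v. v"]
    by (simp_all add: integrable_gauss integral_gauss)
  show **: "integrable M (\<lambda>\<omega>. (V \<omega> - \<mu>)\<^sup>2)" "(\<integral>\<omega>. (V \<omega> - \<mu>)\<^sup>2 \<partial>M) = \<tau>\<^sup>2"
    using integrable_normal_moment[OF tau, of \<mu> 2] integral_normal_moment_even[OF tau, of \<mu> 1] tau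
      integrable_value[of "\<lambda>v. (v - \<mu>)\<^sup>2"] integral_value[of "\<lambda>v. (v - \<mu>)\<^sup>2"]
    by (simp_all add: integrable_gauss integral_gauss)
  have "integrable M (\<lambda>\<omega>. (V \<omega> - \<mu>)\<^sup>2 + 2 * \<mu> * V \<omega> - \<mu>\<^sup>2)"
    using * ** by simp
  then show "integrable M (\<lambda>\<omega>. (V \<omega>)\<^sup>2)"
    by (simp add: power2_diff algebra_simps)
qed

lemma noise_moments:
  "integrable M U" "(\<integral>\<omega>. U \<omega> \<partial>M) = 0"
  "integrable M (\<lambda>\<omega>. (U \<omega>)\<^sup>2)" "(\<integral>\<omega>. (U \<omega>)\<^sup>2 \<partial>M) = \<sigma>\<^sup>2"
proof -
  show "integrable M U" "(\<integral>\<omega>. U \<omega> \<partial>M) = 0"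
    using integrable_normal_moment_nz_1[OF sigma] integral_normal_moment_nz_1[OF sigma]
      integrable_noise[of "\<lambda>v. v"] integral_noise[of "\<lambda>v. v"]
    by (simp_all add: integrable_gauss integral_gauss)
  show "integrable M (\<lambda>\<omega>. (U \<omega>)\<^sup>2)" "(\<integral>\<omega>. (U \<omega>)\<^sup>2 \<partial>M) = \<sigma>\<^sup>2"
    using integrable_normal_moment[OF sigma, of 0 2] integral_normal_moment_even[OF sigma, of 0 1] sigma
      integrable_noise[of "\<lambda>v. v\<^sup>2"] integral_noise[of "\<lambda>v. v\<^sup>2"]
    by (simp_all add: integrable_gauss integral_gauss)
qed

lemma value_noise_uncorrelated: "integrable M (\<lambda>\<omega>. V \<omega> * U \<omega>)" "(\<integral>\<omega>. V \<omega> * U \<omega> \<partial>M) = 0"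
  using indep_var_integrable[OF indep] indep_var_lebesgue_integral[OF indep] value_moments noise_moments
  by simp_all

definition "mean_clip n x = (\<integral>u. clip n (x + u) \<partial>noise_law)"

lemma clip_integrable: "integrable noise_law (\<lambda>u. clip n (x + u))"
  by (rule noise.integrable_const_bound[where B="real n"]) (auto simp: clip_bounds)

lemma mean_clip_measurable [measurable]: "mean_clip n \<in> borel_measurable borel"
  unfolding mean_clip_def by measurable

lemma mean_clip_bound: "\<bar>mean_clip n x\<bar> \<le> real n"
proof -
  have "\<bar>mean_clip n x\<bar> \<le> (\<integral>u. \<bar>clip n (x + u)\<bar> \<partial>noise_law)"
    unfolding mean_clip_def by (rule integral_abs_bound)
  also have "\<dots> \<le> (\<integral>u. real n \<partial>noise_law)"
    using clip_integrable by (intro integral_mono) (auto simp: clip_bounds)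
  also have "\<dots> = real n"
    using noise.prob_space by simp
  finally show ?thesis .
qed

lemma mean_clip_tendsto: "(\<lambda>n. mean_clip n x) \<longlonglongrightarrow> x"
proof -
  have int: "integrable noise_law (\<lambda>u. u)"
    by (rule iffD1[OF integrable_noise noise_moments(1)]) measurable
  have zero: "(\<integral>u. u \<partial>noise_law) = 0"
    by (rule trans[OF integral_noise[symmetric] noise_moments(2)]) measurable
  have "(\<lambda>n. mean_clip n x) \<longlonglongrightarrow> (\<integral>u. x + u \<partial>noise_law)"
    unfolding mean_clip_def
  proof (rule integral_dominated_convergence[where w="\<lambda>u. \<bar>x + u\<bar>"])
    show "integrable noise_law (\<lambda>u. \<bar>x + u\<bar>)" using int by simp
  qed (auto simp: clip_tendsto clip_bounds)
  also have "(\<integral>u. x + u \<partial>noise_law) = x"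
    using int zero noise.prob_space by simp
  finally show ?thesis .
qed

lemma mean_clip_uminus: "mean_clip n (- x) = - mean_clip n x"
proof -
  have "mean_clip n (- x) = (\<integral>u. normal_density 0 \<sigma> u * clip n (- x + u) \<partial>lborel)"
    unfolding mean_clip_def by (rule integral_gauss) measurable
  also have "\<dots> = (\<integral>u. normal_density 0 \<sigma> (- u) * clip n (- x + - u) \<partial>lborel)"
    using lborel_integral_real_affine[of "-1" "\<lambda>u. normal_density 0 \<sigma> u * clip n (- x + u)" 0] by simp
  also have "\<dots> = (\<integral>u. - (normal_density 0 \<sigma> u * clip n (x + u)) \<partial>lborel)"
  proof (rule Bochner_Integration.integral_cong[OF refl])
    fix u
    have "clip n (- x + - u) = - clip n (x + u)"
      unfolding clip_def by (auto simp: max_def min_def)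
    then show "normal_density 0 \<sigma> (- u) * clip n (- x + - u) = - (normal_density 0 \<sigma> u * clip n (x + u))"
      by (simp add: normal_density_def)
  qed
  also have "\<dots> = - mean_clip n x"
    unfolding mean_clip_def by (subst integral_gauss) auto
  finally show ?thesis .
qed

lemma mean_clip_mono: "x \<le> y \<Longrightarrow> mean_clip n x \<le> mean_clip n y"
  unfolding mean_clip_def using clip_integrable by (intro integral_mono) (auto simp: clip_def)

lemma mean_clip_sign: "0 \<le> x * mean_clip n x"
proof -
  have "mean_clip n 0 = 0"
    using mean_clip_uminus[of n 0] by simp
  then show ?thesis
    using mean_clip_mono[of 0 x n] mean_clip_mono[of x 0 n]
    by (cases "x \<ge> 0") (auto simp: zero_le_mult_iff)
qed

end

locale efficient_market = gaussian_market +
  fixes \<phi> P :: "real \<Rightarrow> real"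
  assumes phi_measurable [measurable]: "\<phi> \<in> borel_measurable borel"
    and P_measurable [measurable]: "P \<in> borel_measurable borel"
    and efficient: "market_efficient M V U \<phi> P"
begin

abbreviation "Y \<equiv> order_flow V U \<phi>"

lemma Y_measurable [measurable]: "Y \<in> borel_measurable M"
  unfolding order_flow_def by measurable

definition "flow_info = vimage_algebra (space M) Y borel"

sublocale info: finite_measure_subalgebra M flow_info
proof
  show "subalgebra M flow_info"
    unfolding subalgebra_def flow_info_def
    by (auto simp: sets_vimage_algebra2)
qed

lemma Y_info [measurable]: "Y \<in> flow_info \<rightarrow>\<^sub>M borel"
  unfolding flow_info_def by (rule measurable_vimage_algebra1) simp

lemma price_eq: "AE \<omega> in M. P (Y \<omega>) = real_cond_exp M flow_info V \<omega>"
  using efficient by (simp add: market_efficient_def flow_info_def Let_def)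

lemma price_orthogonal:
  assumes [measurable]: "f \<in> borel_measurable borel"
    and "integrable M (\<lambda>\<omega>. f (Y \<omega>) * V \<omega>)"
  shows "integrable M (\<lambda>\<omega>. f (Y \<omega>) * P (Y \<omega>))"
    and "(\<integral>\<omega>. f (Y \<omega>) * P (Y \<omega>) \<partial>M) = (\<integral>\<omega>. f (Y \<omega>) * V \<omega> \<partial>M)"
proof -
  have *: "(\<lambda>\<omega>. f (Y \<omega>)) \<in> borel_measurable flow_info" by measurable
  have ae: "AE \<omega> in M. f (Y \<omega>) * real_cond_exp M flow_info V \<omega> = f (Y \<omega>) * P (Y \<omega>)"
    using price_eq by eventually_elim simp
  show "integrable M (\<lambda>\<omega>. f (Y \<omega>) * P (Y \<omega>))"
    by (rule integrable_cong_AE_imp[OF info.real_cond_exp_intg(1)[OF assms(2) * V_measurable] _ ae])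
      measurable
  have "(\<integral>\<omega>. f (Y \<omega>) * P (Y \<omega>) \<partial>M) = (\<integral>\<omega>. f (Y \<omega>) * real_cond_exp M flow_info V \<omega> \<partial>M)"
    using price_eq by (intro integral_cong_AE) auto
  then show "(\<integral>\<omega>. f (Y \<omega>) * P (Y \<omega>) \<partial>M) = (\<integral>\<omega>. f (Y \<omega>) * V \<omega> \<partial>M)"
    using info.real_cond_exp_intg(2)[OF assms(2) * V_measurable] by simp
qed

lemma price_square_integrable: "integrable M (\<lambda>\<omega>. (P (Y \<omega>))\<^sup>2)"
proof -
  have int: "integrable M (\<lambda>\<omega>. (real_cond_exp M flow_info V \<omega>)\<^sup>2)"
    by (rule info.integrable_convex_cond_exp[where I=UNIV and q="\<lambda>x. x\<^sup>2"])
      (auto simp: value_moments convex_power2)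
  have ae: "AE \<omega> in M. (real_cond_exp M flow_info V \<omega>)\<^sup>2 = (P (Y \<omega>))\<^sup>2"
    using price_eq by eventually_elim simp
  show ?thesis
    by (rule integrable_cong_AE_imp[OF int _ ae]) measurable
qed

end

section \<open>Market efficiency bounds the loss of the noise traders\<close>

context efficient_market
begin

definition "noise_loss = (\<integral>\<omega>. P (Y \<omega>) * U \<omega> \<partial>M)"

lemma price_integrable:
  "integrable M (\<lambda>\<omega>. P (Y \<omega>))"
  "integrable M (\<lambda>\<omega>. P (Y \<omega>) * U \<omega>)"
  "integrable M (\<lambda>\<omega>. P (Y \<omega>) * V \<omega>)"
  using integrable_mult_square[where f="\<lambda>\<omega>. P (Y \<omega>)" and g="\<lambda>_. 1" and M=M]
    integrable_mult_square[where f="\<lambda>\<omega>. P (Y \<omega>)" and g=U and M=M]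
    integrable_mult_square[where f="\<lambda>\<omega>. P (Y \<omega>)" and g=V and M=M]
    price_square_integrable noise_moments(3) value_moments(3)
  by simp_all

lemma price_moments:
  "(\<integral>\<omega>. P (Y \<omega>) \<partial>M) = \<mu>"
  "(\<integral>\<omega>. (P (Y \<omega>))\<^sup>2 \<partial>M) = (\<integral>\<omega>. P (Y \<omega>) * V \<omega> \<partial>M)"
  using price_orthogonal(2)[of "\<lambda>_. 1"] price_orthogonal(2)[of P] value_moments price_integrable(3)
  by (simp_all add: power2_eq_square)

text \<open>The price is the orthogonal projection of \<open>V\<close>, so \<open>2 * P(Y) - V\<close> is the mirror image of \<open>V\<close> in
  the space of functions of \<open>Y\<close>, and that space contains the constant \<open>\<mu>\<close>.\<close>

lemma reflection_norm:
  "integrable M (\<lambda>\<omega>. (2 * P (Y \<omega>) - V \<omega> - \<mu>)\<^sup>2)"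
  "(\<integral>\<omega>. (2 * P (Y \<omega>) - V \<omega> - \<mu>)\<^sup>2 \<partial>M) = \<tau>\<^sup>2"
proof -
  have eq: "(2 * P (Y \<omega>) - V \<omega> - \<mu>)\<^sup>2 = (V \<omega> - \<mu>)\<^sup>2
      + 4 * ((P (Y \<omega>))\<^sup>2 - P (Y \<omega>) * V \<omega>) - 4 * \<mu> * (P (Y \<omega>) - V \<omega>)" for \<omega>
    by (simp add: power2_eq_square algebra_simps)
  show "integrable M (\<lambda>\<omega>. (2 * P (Y \<omega>) - V \<omega> - \<mu>)\<^sup>2)"
    unfolding eq using value_moments price_integrable price_square_integrable by simp
  show "(\<integral>\<omega>. (2 * P (Y \<omega>) - V \<omega> - \<mu>)\<^sup>2 \<partial>M) = \<tau>\<^sup>2"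
    unfolding eq using value_moments price_integrable price_square_integrable price_moments by simp
qed

text \<open>The defect in the Cauchy-Schwarz inequality for the reflected value and the noise, written as a
  square so that it yields both the bound on the loss and its equality case.\<close>

lemma noise_loss_defect:
  "integrable M (\<lambda>\<omega>. (\<sigma> * (2 * P (Y \<omega>) - V \<omega> - \<mu>) - \<tau> * U \<omega>)\<^sup>2)"
  "(\<integral>\<omega>. (\<sigma> * (2 * P (Y \<omega>) - V \<omega> - \<mu>) - \<tau> * U \<omega>)\<^sup>2 \<partial>M) =
    2 * \<sigma> * \<tau> * (\<sigma> * \<tau> - 2 * noise_loss)"
proof -
  have eq: "(\<sigma> * (2 * P (Y \<omega>) - V \<omega> - \<mu>) - \<tau> * U \<omega>)\<^sup>2 =
      \<sigma>\<^sup>2 * (2 * P (Y \<omega>) - V \<omega> - \<mu>)\<^sup>2 + \<tau>\<^sup>2 * (U \<omega>)\<^sup>2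
      - 2 * \<sigma> * \<tau> * (2 * (P (Y \<omega>) * U \<omega>) - V \<omega> * U \<omega> - \<mu> * U \<omega>)" for \<omega>
    by (simp add: power2_eq_square algebra_simps)
  note facts = reflection_norm noise_moments value_noise_uncorrelated price_integrable
  show "integrable M (\<lambda>\<omega>. (\<sigma> * (2 * P (Y \<omega>) - V \<omega> - \<mu>) - \<tau> * U \<omega>)\<^sup>2)"
    unfolding eq using facts by simp
  have "(\<integral>\<omega>. (\<sigma> * (2 * P (Y \<omega>) - V \<omega> - \<mu>) - \<tau> * U \<omega>)\<^sup>2 \<partial>M) =
      \<sigma>\<^sup>2 * \<tau>\<^sup>2 + \<tau>\<^sup>2 * \<sigma>\<^sup>2 - 2 * \<sigma> * \<tau> * (2 * noise_loss)"
    unfolding eq using facts by (simp add: noise_loss_def)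
  then show "(\<integral>\<omega>. (\<sigma> * (2 * P (Y \<omega>) - V \<omega> - \<mu>) - \<tau> * U \<omega>)\<^sup>2 \<partial>M) =
    2 * \<sigma> * \<tau> * (\<sigma> * \<tau> - 2 * noise_loss)"
    by (simp add: power2_eq_square algebra_simps)
qed

lemma noise_loss_le: "2 * noise_loss \<le> \<sigma> * \<tau>"
proof -
  have "0 \<le> 2 * \<sigma> * \<tau> * (\<sigma> * \<tau> - 2 * noise_loss)"
    unfolding noise_loss_defect(2)[symmetric] by simp
  then show ?thesis
    using mult_pos_pos[OF sigma tau] by (auto simp: zero_le_mult_iff)
qed

lemma noise_loss_eq:
  assumes "2 * noise_loss = \<sigma> * \<tau>"
  shows "AE \<omega> in M. \<sigma> * (2 * P (Y \<omega>) - V \<omega> - \<mu>) = \<tau> * U \<omega>"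
proof -
  have "AE \<omega> in M. (\<sigma> * (2 * P (Y \<omega>) - V \<omega> - \<mu>) - \<tau> * U \<omega>)\<^sup>2 = 0"
    using integral_nonneg_eq_0_iff_AE[OF noise_loss_defect(1)] noise_loss_defect(2) assms by simp
  then show ?thesis
    by eventually_elim simp
qed

definition "mean_price x = (\<integral>u. P (x + u) \<partial>noise_law)"
definition "price_impact x = (\<integral>u. P (x + u) * u \<partial>noise_law) / \<sigma>\<^sup>2"

lemma mean_price_measurable [measurable]: "mean_price \<in> borel_measurable borel"
  unfolding mean_price_def by measurable

text \<open>By Fubini, almost every \<open>v\<close> makes \<open>P(\<phi> v + \<cdot>)\<close> square integrable.  One such \<open>v\<close> suffices, because
  exponential integrability survives the translation from \<open>\<phi> v\<close> to \<open>x\<close>.\<close>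

lemma price_exp_integrable: "exp_integrable noise_law (\<lambda>u. P (x + u))"
proof -
  have "AE v in value_law. integrable noise_law (\<lambda>u. (P (\<phi> v + u))\<^sup>2)"
    using disintegrate_noise(3)[of "\<lambda>(v, u). (P (\<phi> v + u))\<^sup>2"] price_square_integrable
    by (simp add: order_flow_def)
  moreover have "\<not> (AE v in value_law. False)"
    by simp
  ultimately obtain v where "integrable noise_law (\<lambda>u. (P (\<phi> v + u))\<^sup>2)"
    by (metis (mono_tags, lifting) eventually_mono)
  then have "exp_integrable noise_law (\<lambda>u. P (\<phi> v + u))"
    by (intro exp_integrable_square sigma) measurable
  from exp_integrable_shift[OF sigma this, of "x - \<phi> v"] show ?thesis
    by (simp add: algebra_simps)
qed

lemma price_shift_integrable:
  "integrable noise_law (\<lambda>u. P (x + u))" "integrable M (\<lambda>\<omega>. P (x + U \<omega>))"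
  "(\<integral>\<omega>. P (x + U \<omega>) \<partial>M) = mean_price x"
  using price_exp_integrable[of x] integrable_noise[of "\<lambda>u. P (x + u)"] integral_noise[of "\<lambda>u. P (x + u)"]
  unfolding exp_integrable_def mean_price_def by (auto dest!: spec[of _ "0::real"])

lemma mean_price_derivative: "(mean_price has_real_derivative price_impact x) (at x)"
proof -
  have "((\<lambda>e. \<integral>u. P (x + (u + e)) \<partial>noise_law) has_real_derivative price_impact x) (at 0)"
    using gauss_shift_derivative[OF sigma price_exp_integrable[of x]] by (simp add: price_impact_def)
  then have "((\<lambda>e. mean_price (x + e)) has_real_derivative price_impact x) (at 0)"
    by (simp add: mean_price_def algebra_simps)
  then show ?thesis
    using DERIV_shift[of mean_price "price_impact x" 0 x] by (simp add: add.commute)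
qed

lemma price_impact_integral:
  "integrable value_law (\<lambda>v. price_impact (\<phi> v))"
  "\<sigma>\<^sup>2 * (\<integral>v. price_impact (\<phi> v) \<partial>value_law) = noise_loss"
  using disintegrate_noise(1,2)[of "\<lambda>(v, u). P (\<phi> v + u) * u"] price_integrable(2) sigma
  by (simp_all add: price_impact_def noise_loss_def order_flow_def)

end

section \<open>Profit maximisation against an efficient price\<close>

locale equilibrium_market = efficient_market +
  assumes maximising: "profit_maximising M U \<phi> P"
begin

definition "profit v = (v - mean_price (\<phi> v)) * \<phi> v"

lemma expected_profit: "(\<integral>\<omega>. (v - P (x + U \<omega>)) * x \<partial>M) = (v - mean_price x) * x"
  using price_shift_integrable[of x] prob_space by simp

lemma profit_optimal: "(v - mean_price x) * x \<le> profit v"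
  using maximising unfolding profit_maximising_def is_arg_max_def expected_profit profit_def
  by (meson UNIV_I not_less)

lemma profit_nonneg: "0 \<le> profit v"
  using profit_optimal[of v 0] by simp

text \<open>An insider who has seen \<open>v'\<close> can place the order \<open>\<phi> v\<close>, whose profit is affine in \<open>v'\<close>.\<close>

lemma profit_subgradient: "profit v + \<phi> v * (v' - v) \<le> profit v'"
  using profit_optimal[of v' "\<phi> v"] by (simp add: profit_def algebra_simps)

text \<open>The order \<open>\<phi> v\<close> is an interior maximum of the differentiable function \<open>x \<mapsto> (v - h x) * x\<close>.\<close>

lemma first_order_condition: "v - mean_price (\<phi> v) = \<phi> v * price_impact (\<phi> v)"
proof -
  have "((\<lambda>x. (v - mean_price x) * x) has_real_derivative
      v - mean_price (\<phi> v) - price_impact (\<phi> v) * \<phi> v) (at (\<phi> v))"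
    by (auto intro!: derivative_eq_intros mean_price_derivative)
  then have "v - mean_price (\<phi> v) - price_impact (\<phi> v) * \<phi> v = 0"
    using profit_optimal[of v] by (intro DERIV_local_max[where d=1]) (auto simp: profit_def)
  then show ?thesis
    by (simp add: mult.commute)
qed

lemma profit_impact: "profit v = (\<phi> v)\<^sup>2 * price_impact (\<phi> v)"
  by (simp add: profit_def first_order_condition power2_eq_square)

text \<open>The first order condition recovers \<open>v\<close> from \<open>\<phi> v\<close>, so the monotone \<open>\<phi>\<close> is strictly increasing.
  It takes both signs: if it were, say, nonnegative everywhere, the convex function \<open>profit\<close> would
  be bounded towards \<open>-\<infinity>\<close>, yet selling one unit there earns arbitrarily much.\<close>

lemma strategy_sign_change: "\<exists>v1. (\<forall>v<v1. \<phi> v < 0) \<and> (\<forall>v>v1. \<phi> v > 0)"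
proof -
  have mono: "mono \<phi>"
    by (rule subgradient_mono[OF profit_subgradient])
  have inj: "v = v'" if "\<phi> v = \<phi> v'" for v v'
    using first_order_condition[of v] first_order_condition[of v'] that by simp
  have strict: "\<phi> u < \<phi> v" if "u < v" for u v
    using monoD[OF mono, of u v] inj[of u v] that by (auto simp: less_le)
  have neg: "\<exists>v. \<phi> v < 0"
  proof (rule ccontr)
    assume "\<not> (\<exists>v. \<phi> v < 0)"
    then have nonneg: "\<phi> v \<ge> 0" for v by (simp add: not_less)
    \<comment> \<open>low enough that selling one unit earns more than \<open>profit 0\<close>\<close>
    define v where "v = - (\<bar>profit 0\<bar> + \<bar>mean_price (- 1)\<bar> + 1)"
    have "\<phi> v * (0 - v) \<ge> 0"
      using nonneg[of v] by (simp add: v_def)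
    then have "profit v \<le> profit 0"
      using profit_subgradient[of v 0] by simp
    moreover have "mean_price (- 1) - v \<le> profit v"
      using profit_optimal[of v "- 1"] by simp
    ultimately show False
      by (simp add: v_def)
  qed
  have pos: "\<exists>v. \<phi> v > 0"
  proof (rule ccontr)
    assume "\<not> (\<exists>v. \<phi> v > 0)"
    then have nonpos: "\<phi> v \<le> 0" for v by (simp add: not_less)
    \<comment> \<open>high enough that buying one unit earns more than \<open>profit 0\<close>\<close>
    define v where "v = \<bar>profit 0\<bar> + \<bar>mean_price 1\<bar> + 1"
    have "\<phi> v * (0 - v) \<ge> 0"
      by (intro mult_nonpos_nonpos nonpos) (simp add: v_def)
    then have "profit v \<le> profit 0"
      using profit_subgradient[of v 0] by simp
    moreover have "v - mean_price 1 \<le> profit v"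
      using profit_optimal[of v 1] by simp
    ultimately show False
      by (simp add: v_def)
  qed
  define S where "S = {v. \<phi> v < 0}"
  obtain b where b: "\<phi> b > 0" using pos by blast
  have bdd: "bdd_above S"
  proof (rule bdd_aboveI)
    fix v assume "v \<in> S"
    then show "v \<le> b"
      using monoD[OF mono, of b v] b by (cases "v \<le> b") (auto simp: S_def)
  qed
  have "S \<noteq> {}" using neg unfolding S_def by blast
  have "\<phi> v < 0" if below: "v < Sup S" for v
  proof -
    obtain u where "u \<in> S" "v < u"
      by (rule less_cSupE[OF below \<open>S \<noteq> {}\<close>])
    then show ?thesis
      using strict[of v u] by (simp add: S_def)
  qed
  moreover have "\<phi> v > 0" if "v > Sup S" for v
  proof -
    define u where "u = (v + Sup S) / 2"
    have "u > Sup S" "u < v" using that by (auto simp: u_def)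
    then have "u \<notin> S" using cSup_upper[OF _ bdd, of u] by auto
    then show ?thesis
      using strict[OF \<open>u < v\<close>] by (simp add: S_def)
  qed
  ultimately show ?thesis by blast
qed

text \<open>Efficiency tested against \<open>clip n Y\<close>, after subtracting \<open>E (P(Y) * mean_clip n (\<phi> V))\<close> on both sides;
  Fubini's theorem turns that term into \<open>E (mean_price (\<phi> V) * mean_clip n (\<phi> V))\<close>.  What remains on the right involves \<open>Y\<close> only through its deviation from \<open>\<phi> V\<close>, that is,
  through the noise.\<close>

lemma clipped_profit_integral:
  "integrable value_law (\<lambda>v. (v - mean_price (\<phi> v)) * mean_clip n (\<phi> v))"
  "(\<integral>v. (v - mean_price (\<phi> v)) * mean_clip n (\<phi> v) \<partial>value_law) =
    (\<integral>\<omega>. P (Y \<omega>) * (clip n (Y \<omega>) - mean_clip n (\<phi> (V \<omega>))) \<partial>M)"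
proof -
  have int_VQ: "integrable M (\<lambda>\<omega>. clip n (Y \<omega>) * V \<omega>)"
  proof (rule Bochner_Integration.integrable_bound[of _ "\<lambda>\<omega>. real n * V \<omega>"])
    show "AE \<omega> in M. norm (clip n (Y \<omega>) * V \<omega>) \<le> norm (real n * V \<omega>)"
      using clip_bounds(1) by (auto simp: abs_mult intro!: mult_right_mono)
  qed (use value_moments in simp_all)
  have int_PQ: "integrable M (\<lambda>\<omega>. clip n (Y \<omega>) * P (Y \<omega>))"
    and eq_PQ: "(\<integral>\<omega>. clip n (Y \<omega>) * P (Y \<omega>) \<partial>M) = (\<integral>\<omega>. clip n (Y \<omega>) * V \<omega> \<partial>M)"
    using price_orthogonal[OF clip_measurable int_VQ] by auto
  have int_Pk: "integrable M (\<lambda>\<omega>. P (Y \<omega>) * mean_clip n (\<phi> (V \<omega>)))"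
  proof (rule Bochner_Integration.integrable_bound[of _ "\<lambda>\<omega>. P (Y \<omega>) * real n"])
    show "AE \<omega> in M. norm (P (Y \<omega>) * mean_clip n (\<phi> (V \<omega>))) \<le> norm (P (Y \<omega>) * real n)"
      using mean_clip_bound by (auto simp: abs_mult intro!: mult_left_mono)
  qed (use price_integrable(1) in simp_all)
  have 1: "integrable value_law (\<lambda>v. v * mean_clip n (\<phi> v))"
    "(\<integral>v. v * mean_clip n (\<phi> v) \<partial>value_law) = (\<integral>\<omega>. clip n (Y \<omega>) * V \<omega> \<partial>M)"
    using disintegrate_noise(1,2)[of "\<lambda>(v, u). v * clip n (\<phi> v + u)"] int_VQ
    by (simp_all add: mean_clip_def order_flow_def mult.commute)
  have 2: "integrable value_law (\<lambda>v. mean_price (\<phi> v) * mean_clip n (\<phi> v))"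
    "(\<integral>v. mean_price (\<phi> v) * mean_clip n (\<phi> v) \<partial>value_law) =
      (\<integral>\<omega>. P (Y \<omega>) * mean_clip n (\<phi> (V \<omega>)) \<partial>M)"
    using disintegrate_noise(1,2)[of "\<lambda>(v, u). P (\<phi> v + u) * mean_clip n (\<phi> v)"] int_Pk
    by (simp_all add: mean_price_def order_flow_def)
  show "integrable value_law (\<lambda>v. (v - mean_price (\<phi> v)) * mean_clip n (\<phi> v))"
    unfolding left_diff_distrib using 1 2 by simp
  have "(\<integral>v. (v - mean_price (\<phi> v)) * mean_clip n (\<phi> v) \<partial>value_law) =
      (\<integral>\<omega>. clip n (Y \<omega>) * P (Y \<omega>) \<partial>M) - (\<integral>\<omega>. P (Y \<omega>) * mean_clip n (\<phi> (V \<omega>)) \<partial>M)"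
    unfolding left_diff_distrib using 1 2 eq_PQ by simp
  also have "\<dots> = (\<integral>\<omega>. P (Y \<omega>) * (clip n (Y \<omega>) - mean_clip n (\<phi> (V \<omega>))) \<partial>M)"
    unfolding right_diff_distrib using int_PQ int_Pk by (simp add: mult.commute)
  finally show "(\<integral>v. (v - mean_price (\<phi> v)) * mean_clip n (\<phi> v) \<partial>value_law) =
    (\<integral>\<omega>. P (Y \<omega>) * (clip n (Y \<omega>) - mean_clip n (\<phi> (V \<omega>))) \<partial>M)" .
qed

text \<open>The Lipschitz bound makes \<open>clip n Y - mean_clip n (\<phi> V)\<close> at most \<open>\<bar>U\<bar> + E \<bar>U\<bar>\<close>, uniformly in \<open>n\<close>
  and regardless of the size of \<open>\<phi> V\<close>; this dominates the right-hand sides of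
  \<open>clipped_profit_integral\<close>.\<close>

lemma clipped_profit_tendsto:
  "(\<lambda>n. \<integral>v. (v - mean_price (\<phi> v)) * mean_clip n (\<phi> v) \<partial>value_law) \<longlonglongrightarrow> noise_loss"
proof -
  define C where "C = (\<integral>u. \<bar>u\<bar> \<partial>noise_law)"
  have int_abs: "integrable noise_law (\<lambda>u. \<bar>u\<bar>)"
    by (rule iffD1[OF integrable_noise integrable_abs[OF noise_moments(1)]]) measurable
  have dev: "\<bar>clip n x - mean_clip n x\<bar> \<le> C" for n x
  proof -
    have "\<bar>clip n x - mean_clip n x\<bar> = \<bar>\<integral>u. clip n x - clip n (x + u) \<partial>noise_law\<bar>"
      unfolding mean_clip_def using clip_integrable noise.prob_space by simp
    also have "\<dots> \<le> (\<integral>u. \<bar>clip n x - clip n (x + u)\<bar> \<partial>noise_law)"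
      by (rule integral_abs_bound)
    also have "\<dots> \<le> C"
      unfolding C_def
    proof (rule integral_mono)
      show "\<bar>clip n x - clip n (x + u)\<bar> \<le> \<bar>u\<bar>" for u
        using clip_bounds(3)[of n x "x + u"] by simp
    qed (use clip_integrable int_abs in simp_all)
    finally show ?thesis .
  qed
  have "(\<lambda>n. \<integral>\<omega>. P (Y \<omega>) * (clip n (Y \<omega>) - mean_clip n (\<phi> (V \<omega>))) \<partial>M)
      \<longlonglongrightarrow> (\<integral>\<omega>. P (Y \<omega>) * (Y \<omega> - \<phi> (V \<omega>)) \<partial>M)"
  proof (rule integral_dominated_convergence[where w="\<lambda>\<omega>. \<bar>P (Y \<omega>) * U \<omega>\<bar> + \<bar>P (Y \<omega>)\<bar> * C"])
    show "integrable M (\<lambda>\<omega>. \<bar>P (Y \<omega>) * U \<omega>\<bar> + \<bar>P (Y \<omega>)\<bar> * C)"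
      using price_integrable by simp
    show "AE \<omega> in M. (\<lambda>n. P (Y \<omega>) * (clip n (Y \<omega>) - mean_clip n (\<phi> (V \<omega>))))
        \<longlonglongrightarrow> P (Y \<omega>) * (Y \<omega> - \<phi> (V \<omega>))"
      by (intro AE_I2 tendsto_intros clip_tendsto mean_clip_tendsto)
    show "AE \<omega> in M. norm (P (Y \<omega>) * (clip n (Y \<omega>) - mean_clip n (\<phi> (V \<omega>))))
        \<le> \<bar>P (Y \<omega>) * U \<omega>\<bar> + \<bar>P (Y \<omega>)\<bar> * C" for n
    proof (rule AE_I2)
      fix \<omega>
      have "\<bar>clip n (Y \<omega>) - mean_clip n (\<phi> (V \<omega>))\<bar> \<le> \<bar>U \<omega>\<bar> + C"
        using dev[of n "\<phi> (V \<omega>)"] clip_bounds(3)[of n "Y \<omega>" "\<phi> (V \<omega>)"]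
        by (simp add: order_flow_def)
      then have "\<bar>P (Y \<omega>)\<bar> * \<bar>clip n (Y \<omega>) - mean_clip n (\<phi> (V \<omega>))\<bar> \<le> \<bar>P (Y \<omega>)\<bar> * (\<bar>U \<omega>\<bar> + C)"
        by (rule mult_left_mono) simp
      then show "norm (P (Y \<omega>) * (clip n (Y \<omega>) - mean_clip n (\<phi> (V \<omega>))))
        \<le> \<bar>P (Y \<omega>) * U \<omega>\<bar> + \<bar>P (Y \<omega>)\<bar> * C"
        by (simp add: abs_mult distrib_left)
    qed
  qed measurable
  then show ?thesis
    unfolding clipped_profit_integral(2) by (simp add: noise_loss_def order_flow_def)
qed

lemma clipped_profit_nonneg: "0 \<le> (v - mean_price (\<phi> v)) * mean_clip n (\<phi> v)"
proof (cases "\<phi> v = 0")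
  case True
  then show ?thesis using mean_clip_uminus[of n 0] by simp
next
  case False
  have "0 \<le> profit v * (\<phi> v * mean_clip n (\<phi> v))"
    by (intro mult_nonneg_nonneg profit_nonneg mean_clip_sign)
  also have "\<dots> = (\<phi> v)\<^sup>2 * ((v - mean_price (\<phi> v)) * mean_clip n (\<phi> v))"
    by (simp add: profit_def power2_eq_square)
  finally show ?thesis
    using False by (simp add: zero_le_mult_iff)
qed

text \<open>Equality is expected here, but passing to the limit on the side of the insider is only possible by
  Fatou's lemma: nonnegativity of the clipped profits replaces a dominating function.\<close>

lemma profit_le_noise_loss:
  "integrable value_law profit" "(\<integral>v. profit v \<partial>value_law) \<le> noise_loss"
proof -
  define p where "p = (\<lambda>n v. (v - mean_price (\<phi> v)) * mean_clip n (\<phi> v))"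
  have [measurable]: "profit \<in> borel_measurable borel"
    unfolding profit_def by measurable
  have [measurable]: "p n \<in> borel_measurable borel" for n
    unfolding p_def by measurable
  have nonneg: "0 \<le> noise_loss"
    by (rule LIMSEQ_le_const[OF clipped_profit_tendsto])
      (intro exI allI impI Bochner_Integration.integral_nonneg clipped_profit_nonneg)
  have "(\<integral>\<^sup>+v. ennreal (profit v) \<partial>value_law) = (\<integral>\<^sup>+v. liminf (\<lambda>n. ennreal (p n v)) \<partial>value_law)"
  proof (rule nn_integral_cong)
    fix v
    have "(\<lambda>n. p n v) \<longlonglongrightarrow> profit v"
      unfolding p_def profit_def by (intro tendsto_intros mean_clip_tendsto)
    from lim_imp_Liminf[OF trivial_limit_sequentially tendsto_ennrealI[OF this]]
    show "ennreal (profit v) = liminf (\<lambda>n. ennreal (p n v))"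
      by simp
  qed
  also have "\<dots> \<le> liminf (\<lambda>n. \<integral>\<^sup>+v. ennreal (p n v) \<partial>value_law)"
    by (rule nn_integral_liminf) measurable
  also have "\<dots> = liminf (\<lambda>n. ennreal (\<integral>v. p n v \<partial>value_law))"
    using clipped_profit_integral(1) clipped_profit_nonneg
    by (simp add: p_def nn_integral_eq_integral)
  also have "\<dots> = ennreal noise_loss"
    using tendsto_ennrealI[OF clipped_profit_tendsto] by (simp add: p_def lim_imp_Liminf)
  finally have *: "(\<integral>\<^sup>+v. ennreal (profit v) \<partial>value_law) \<le> ennreal noise_loss" .
  then show "integrable value_law profit"
    using profit_nonneg by (intro integrableI_nonneg) (auto simp: top_unique intro: le_less_trans)
  show "(\<integral>v. profit v \<partial>value_law) \<le> noise_loss"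
    using * nonneg profit_nonneg
    by (subst integral_eq_nn_integral) (auto intro: enn2real_leI)
qed

text \<open>The first term of \<open>\<sigma>\<^sup>2 * E price_impact (\<phi> V) + E profit V\<close> equals the loss of the noise traders
  and the second is at most that loss, so the sum is at most \<open>2 * noise_loss \<le> \<sigma> * \<tau>\<close>.  The rigidity lemma makes every inequality an equality.\<close>

theorem strategy_linear: "\<phi> v = \<sigma> / \<tau> * (v - \<mu>)"
  and price_linear: "AE \<omega> in M. P (Y \<omega>) = \<mu> + \<tau> / (2 * \<sigma>) * Y \<omega>"
proof -
  obtain v1 where neg: "\<And>v. v < v1 \<Longrightarrow> \<phi> v < 0" and pos: "\<And>v. v > v1 \<Longrightarrow> \<phi> v > 0"
    using strategy_sign_change by blast
  have le: "\<sigma>\<^sup>2 * (\<integral>v. price_impact (\<phi> v) \<partial>value_law) + (\<integral>v. profit v \<partial>value_law)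
      \<le> 2 * noise_loss"
    using profit_le_noise_loss(2) price_impact_integral(2) by simp
  have bound: "\<sigma>\<^sup>2 * (\<integral>v. price_impact (\<phi> v) \<partial>value_law) + (\<integral>v. profit v \<partial>value_law)
      \<le> \<sigma> * \<tau>"
    using le noise_loss_le by linarith
  note facts = tau sigma profit_subgradient profit_impact neg pos profit_nonneg
    profit_le_noise_loss(1) price_impact_integral(1) bound
  show lin: "\<phi> v = \<sigma> / \<tau> * (v - \<mu>)" for v
    using facts by (rule convex_profit_rigidity(1))
  have "\<sigma>\<^sup>2 * (\<integral>v. price_impact (\<phi> v) \<partial>value_law) + (\<integral>v. profit v \<partial>value_law) = \<sigma> * \<tau>"
    using facts by (rule convex_profit_rigidity(2))
  then have "2 * noise_loss = \<sigma> * \<tau>"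
    using le noise_loss_le by linarith
  from noise_loss_eq[OF this]
  show "AE \<omega> in M. P (Y \<omega>) = \<mu> + \<tau> / (2 * \<sigma>) * Y \<omega>"
  proof eventually_elim
    case (elim \<omega>)
    have "\<sigma> * (2 * P (Y \<omega>)) = \<sigma> * (V \<omega> + \<mu>) + \<tau> * U \<omega>"
      using elim by (simp add: algebra_simps)
    then have "P (Y \<omega>) = (V \<omega> + \<mu>) / 2 + \<tau> / (2 * \<sigma>) * U \<omega>"
      using sigma by (simp add: field_simps)
    also have "\<dots> = \<mu> + \<tau> / (2 * \<sigma>) * Y \<omega>"
      using sigma tau by (simp add: order_flow_def lin field_simps)
    finally show ?case .
  qed
qed

end

section \<open>The linear pair is an equilibrium\<close>

context gaussian_market
begin

text \<open>Rescaling exchanges the roles of value and noise without changing their joint law.  The linear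
  order flow is invariant under this exchange, whereas the pricing error
  \<open>V - \<mu> - \<tau> / (2 * \<sigma>) * Y\<close> changes sign; so the error has mean zero on every event determined by
  \<open>Y\<close>.\<close>

lemma swapped_market:
  "gaussian_market M (\<lambda>\<omega>. \<mu> + \<tau> / \<sigma> * U \<omega>) (\<lambda>\<omega>. \<sigma> / \<tau> * (V \<omega> - \<mu>)) \<mu> \<tau> \<sigma>"
proof
  show "\<tau> > 0" "\<sigma> > 0" by (rule tau sigma)+
  show "distributed M lborel (\<lambda>\<omega>. \<mu> + \<tau> / \<sigma> * U \<omega>) (normal_density \<mu> \<tau>)"
    using normal_density_affine[OF distr_U sigma, of "\<tau> / \<sigma>" \<mu>] tau sigma by simp
  have "distributed M lborel (\<lambda>\<omega>. - (\<sigma> / \<tau> * \<mu>) + \<sigma> / \<tau> * V \<omega>) (normal_density 0 \<sigma>)"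
    using normal_density_affine[OF distr_V tau, of "\<sigma> / \<tau>" "- (\<sigma> / \<tau> * \<mu>)"] tau sigma by simp
  also have "(\<lambda>\<omega>. - (\<sigma> / \<tau> * \<mu>) + \<sigma> / \<tau> * V \<omega>) = (\<lambda>\<omega>. \<sigma> / \<tau> * (V \<omega> - \<mu>))"
    by (simp add: right_diff_distrib)
  finally show "distributed M lborel (\<lambda>\<omega>. \<sigma> / \<tau> * (V \<omega> - \<mu>)) (normal_density 0 \<sigma>)" .
  have "indep_var borel ((\<lambda>u. \<mu> + \<tau> / \<sigma> * u) \<circ> U) borel ((\<lambda>v. \<sigma> / \<tau> * (v - \<mu>)) \<circ> V)"
  proof (rule indep_var_compose)
    have "distr M (borel \<Otimes>\<^sub>M borel) (\<lambda>\<omega>. (U \<omega>, V \<omega>)) = noise_law \<Otimes>\<^sub>M value_law"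
    proof -
      have "noise_law \<Otimes>\<^sub>M value_law
          = distr (value_law \<Otimes>\<^sub>M noise_law) (borel \<Otimes>\<^sub>M borel) (\<lambda>(x, y). (y, x))"
        using pair_sigma_finite.distr_pair_swap[of noise_law value_law]
          pair_sigma_finite.intro[OF noise.sigma_finite_measure_axioms valuation.sigma_finite_measure_axioms]
        by (simp cong: distr_cong)
      also have "\<dots> = distr M (borel \<Otimes>\<^sub>M borel) (\<lambda>\<omega>. (U \<omega>, V \<omega>))"
        unfolding joint_law[symmetric] by (subst distr_distr) (simp_all add: o_def)
      finally show ?thesis ..
    qed
    then show "indep_var borel U borel V"
      unfolding indep_var_distribution_eq law_V law_U by simp
  qed measurable
  then show "indep_var borel (\<lambda>\<omega>. \<mu> + \<tau> / \<sigma> * U \<omega>) borel (\<lambda>\<omega>. \<sigma> / \<tau> * (V \<omega> - \<mu>))"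
    by (simp add: o_def)
qed

lemma linear_market_efficient:
  assumes lin: "\<And>v. \<phi> v = \<sigma> / \<tau> * (v - \<mu>)"
    and price: "AE \<omega> in M. P (order_flow V U \<phi> \<omega>) = \<mu> + \<tau> / (2 * \<sigma>) * order_flow V U \<phi> \<omega>"
  shows "market_efficient M V U \<phi> P"
proof -
  interpret swap: gaussian_market M "\<lambda>\<omega>. \<mu> + \<tau> / \<sigma> * U \<omega>" "\<lambda>\<omega>. \<sigma> / \<tau> * (V \<omega> - \<mu>)" \<mu> \<tau> \<sigma>
    by (rule swapped_market)
  define Y where "Y = order_flow V U \<phi>"
  have Y: "Y \<omega> = \<sigma> / \<tau> * (V \<omega> - \<mu>) + U \<omega>" for \<omega>
    by (simp add: Y_def order_flow_def lin)
  have [measurable]: "Y \<in> borel_measurable M"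
    unfolding Y[abs_def] by measurable
  define F where "F = vimage_algebra (space M) Y borel"
  have "subalgebra M F"
    unfolding subalgebra_def F_def by (auto simp: sets_vimage_algebra2)
  then interpret F: finite_measure_subalgebra M F
    by unfold_locales
  have [measurable]: "Y \<in> F \<rightarrow>\<^sub>M borel"
    unfolding F_def by (rule measurable_vimage_algebra1) simp
  define g where "g = (\<lambda>\<omega>. \<mu> + \<tau> / (2 * \<sigma>) * Y \<omega>)"
  have int_g: "integrable M g"
    unfolding g_def Y using value_moments(1) noise_moments(1) by simp
  have "AE \<omega> in M. real_cond_exp M F V \<omega> = g \<omega>"
  proof (rule F.real_cond_exp_charact[OF _ value_moments(1) int_g])
    show "g \<in> borel_measurable F" unfolding g_def by measurable
    fix A assume "A \<in> sets F"
    then obtain B where B: "A = Y -` B \<inter> space M" and [measurable]: "B \<in> sets borel"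
      unfolding F_def by (auto simp: sets_vimage_algebra2)
    \<comment> \<open>the pricing error on the event \<open>A\<close>, as a function of value and noise\<close>
    define G where "G = (\<lambda>(v, u). indicat_real B (\<sigma> / \<tau> * (v - \<mu>) + u) *
      ((v - \<mu>) / 2 - \<tau> / (2 * \<sigma>) * u))"
    have [measurable]: "G \<in> borel_measurable (borel \<Otimes>\<^sub>M borel)"
      unfolding G_def by measurable
    have anti: "G (\<mu> + \<tau> / \<sigma> * U \<omega>, \<sigma> / \<tau> * (V \<omega> - \<mu>)) = - G (V \<omega>, U \<omega>)" for \<omega>
    proof -
      have flow: "\<sigma> / \<tau> * (\<mu> + \<tau> / \<sigma> * U \<omega> - \<mu>) + \<sigma> / \<tau> * (V \<omega> - \<mu>) =
          \<sigma> / \<tau> * (V \<omega> - \<mu>) + U \<omega>"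
        using tau sigma by simp
      have error: "(\<mu> + \<tau> / \<sigma> * U \<omega> - \<mu>) / 2 - \<tau> / (2 * \<sigma>) * (\<sigma> / \<tau> * (V \<omega> - \<mu>)) =
          - ((V \<omega> - \<mu>) / 2 - \<tau> / (2 * \<sigma>) * U \<omega>)"
        using tau sigma by simp
      show ?thesis
        unfolding G_def prod.case flow error by (rule mult_minus_right)
    qed
    have "(\<integral>\<omega>. G (V \<omega>, U \<omega>) \<partial>M) = (\<integral>\<omega>. G (\<mu> + \<tau> / \<sigma> * U \<omega>, \<sigma> / \<tau> * (V \<omega> - \<mu>)) \<partial>M)"
      by (rule trans[OF integral_joint[symmetric] swap.integral_joint]) measurable
    then have zero: "(\<integral>\<omega>. G (V \<omega>, U \<omega>) \<partial>M) = 0"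
      unfolding anti by simp
    have [measurable]: "A \<in> sets M" unfolding B by measurable
    have "(\<integral>\<omega>\<in>A. V \<omega> \<partial>M) - (\<integral>\<omega>\<in>A. g \<omega> \<partial>M) = (\<integral>\<omega>\<in>A. V \<omega> - g \<omega> \<partial>M)"
      using integrable_mult_indicator[OF \<open>A \<in> sets M\<close> value_moments(1)]
        integrable_mult_indicator[OF \<open>A \<in> sets M\<close> int_g]
      by (intro set_integral_diff(2)[symmetric]) (simp_all only: set_integrable_def)
    also have "\<dots> = (\<integral>\<omega>. G (V \<omega>, U \<omega>) \<partial>M)"
      unfolding set_lebesgue_integral_def
    proof (rule Bochner_Integration.integral_cong[OF refl])
      fix \<omega> assume "\<omega> \<in> space M"
      moreover have "V \<omega> - g \<omega> = (V \<omega> - \<mu>) / 2 - \<tau> / (2 * \<sigma>) * U \<omega>"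
        using tau sigma by (simp add: g_def Y field_simps)
      ultimately show "indicat_real A \<omega> *\<^sub>R (V \<omega> - g \<omega>) = G (V \<omega>, U \<omega>)"
        by (simp add: G_def B Y indicator_def)
    qed
    finally show "(\<integral>\<omega>\<in>A. V \<omega> \<partial>M) = (\<integral>\<omega>\<in>A. g \<omega> \<partial>M)"
      using zero by simp
  qed
  then show ?thesis
    using price unfolding market_efficient_def Let_def F_def g_def Y_def
    by eventually_elim simp
qed

text \<open>The price is prescribed only almost surely along the equilibrium flow.  Since the law of \<open>\<phi> v + U\<close>
  and that of \<open>x + U\<close> have the same null sets as Lebesgue measure, it is also linear almost surely
  after any other order \<open>x\<close>.\<close>

lemma linear_profit_maximising:
  assumes lin: "\<And>v. \<phi> v = \<sigma> / \<tau> * (v - \<mu>)"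
    and [measurable]: "P \<in> borel_measurable borel"
    and price: "AE \<omega> in M. P (order_flow V U \<phi> \<omega>) = \<mu> + \<tau> / (2 * \<sigma>) * order_flow V U \<phi> \<omega>"
  shows "profit_maximising M U \<phi> P"
proof -
  have "AE v in value_law. AE u in noise_law. P (\<phi> v + u) = \<mu> + \<tau> / (2 * \<sigma>) * (\<phi> v + u)"
    using AE_joint[of "\<lambda>(v, u). P (\<phi> v + u) = \<mu> + \<tau> / (2 * \<sigma>) * (\<phi> v + u)"] price
    unfolding lin order_flow_def by simp
  moreover have "\<not> (AE v in value_law. False)"
    by simp
  ultimately obtain v0 where "AE u in noise_law. P (\<phi> v0 + u) = \<mu> + \<tau> / (2 * \<sigma>) * (\<phi> v0 + u)"
    by (metis (mono_tags, lifting) eventually_mono)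
  then have ae: "AE u in lborel. P (\<phi> v0 + u) = \<mu> + \<tau> / (2 * \<sigma>) * (\<phi> v0 + u)"
    unfolding AE_gauss[OF sigma] .
  have ae_shift: "AE u in noise_law. P (x + u) = \<mu> + \<tau> / (2 * \<sigma>) * (x + u)" for x
  proof -
    have "AE u in lborel. P (\<phi> v0 + ((x - \<phi> v0) + 1 * u))
        = \<mu> + \<tau> / (2 * \<sigma>) * (\<phi> v0 + ((x - \<phi> v0) + 1 * u))"
      using ae by (intro AE_borel_affine) simp_all
    then show ?thesis
      unfolding AE_gauss[OF sigma] by simp
  qed
  have price_x: "AE \<omega> in M. P (x + U \<omega>) = \<mu> + \<tau> / (2 * \<sigma>) * (x + U \<omega>)" for x
    using ae_shift[of x] unfolding law_U[symmetric] by (subst (asm) AE_distr_iff) simp_all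
  have profit: "(\<integral>\<omega>. (v - P (x + U \<omega>)) * x \<partial>M) = (v - \<mu> - \<tau> / (2 * \<sigma>) * x) * x" for v x
  proof -
    have "(\<integral>\<omega>. (v - P (x + U \<omega>)) * x \<partial>M)
        = (\<integral>\<omega>. (v - (\<mu> + \<tau> / (2 * \<sigma>) * (x + U \<omega>))) * x \<partial>M)"
    proof (rule integral_cong_AE)
      show "AE \<omega> in M. (v - P (x + U \<omega>)) * x = (v - (\<mu> + \<tau> / (2 * \<sigma>) * (x + U \<omega>))) * x"
        using price_x[of x] by eventually_elim simp
    qed measurable
    also have "\<dots> = (v - \<mu> - \<tau> / (2 * \<sigma>) * x) * x"
      using noise_moments(1,2) prob_space by (simp add: distrib_left)
    finally show ?thesis .
  qed
  have "(v - \<mu> - \<tau> / (2 * \<sigma>) * x) * x \<le> (v - \<mu> - \<tau> / (2 * \<sigma>) * \<phi> v) * \<phi> v" for v x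
  proof -
    have "(v - \<mu> - \<tau> / (2 * \<sigma>) * \<phi> v) * \<phi> v - (v - \<mu> - \<tau> / (2 * \<sigma>) * x) * x
        = \<tau> / (2 * \<sigma>) * (\<phi> v - x)\<^sup>2"
      unfolding lin using tau sigma by (simp add: field_simps power2_eq_square)
    moreover have "0 \<le> \<tau> / (2 * \<sigma>) * (\<phi> v - x)\<^sup>2"
      using tau sigma by simp
    ultimately show ?thesis by linarith
  qed
  then show ?thesis
    unfolding profit_maximising_def is_arg_max_def profit by (simp add: not_less)
qed

end

theorem theorem1p1:
  fixes M :: "'a measure" and V U :: "'a \<Rightarrow> real" and \<mu> \<tau> \<sigma> :: real
    and \<phi> P :: "real \<Rightarrow> real"
  assumes "prob_space M"
    and "\<tau> > 0" and "\<sigma> > 0"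
    and "distributed M lborel V (normal_density \<mu> \<tau>)"
    and "distributed M lborel U (normal_density 0 \<sigma>)"
    and "prob_space.indep_var M borel V borel U"
    and "\<phi> \<in> borel_measurable borel" and "P \<in> borel_measurable borel"
  shows "equilibrium M V U \<phi> P \<longleftrightarrow>
    (\<forall>v. \<phi> v = \<sigma> / \<tau> * (v - \<mu>)) \<and>
    (AE \<omega> in M. P (order_flow V U \<phi> \<omega>) = \<mu> + \<tau> / (2 * \<sigma>) * order_flow V U \<phi> \<omega>)"
proof -
  interpret prob_space M by fact
  interpret gaussian_market M V U \<mu> \<tau> \<sigma>
    by unfold_locales (use assms in auto)
  show ?thesis
  proof
    assume eq: "equilibrium M V U \<phi> P"
    interpret equilibrium_market M V U \<mu> \<tau> \<sigma> \<phi> P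
      by unfold_locales (use assms eq in \<open>auto simp: equilibrium_def\<close>)
    show "(\<forall>v. \<phi> v = \<sigma> / \<tau> * (v - \<mu>)) \<and>
      (AE \<omega> in M. P (order_flow V U \<phi> \<omega>) = \<mu> + \<tau> / (2 * \<sigma>) * order_flow V U \<phi> \<omega>)"
      using strategy_linear price_linear by blast
  next
    assume "(\<forall>v. \<phi> v = \<sigma> / \<tau> * (v - \<mu>)) \<and>
      (AE \<omega> in M. P (order_flow V U \<phi> \<omega>) = \<mu> + \<tau> / (2 * \<sigma>) * order_flow V U \<phi> \<omega>)"
    then show "equilibrium M V U \<phi> P"
      using linear_market_efficient linear_profit_maximising assms
      unfolding equilibrium_def by blast
  qed
qed

end
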